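(* Let $A$ be a C$^*$-algebra, let $X$ be an essential Banach $A$-bimodule, and let $T: A\to X$ be a bounded linear operator. Suppose in addition that $A$ is unital or that $X$ is a dual Banach $A$-bimodule. Then the following statements are equivalent: (a) $T$ is anti-derivable at zero, i.e. for all $a,b\in A$, $ab=0$ implies $T(b)a+bT(a)=0$; (b$'$) There exist an anti-derivation $d:A\to X$ and an element $\xi\in X$ satisfying $\xi a = a\xi$, $\xi[a,b]=0$, $T(ab)=bT(a)+T(b)a-b\xi a$, and $T(a)=d(a)+\xi a$, for all $a,b\in A$.
   Context: All algebras and Banach spaces are complex. A Banach $A$-bimodule $X$ is essential if the linear span of $\{axb: a,b\in A,\ x\in X\}$ is dense in $X$. A dual Banach $A$-bimodule is one of the form $X=Y^*$ for a Banach $A$-bimodule $Y$, with operations $(a\phi)(y)=\phi(ya)$, $(\phi a)(y)=\phi(ay)$. The commutator is $[a,b]=ab-ba$. An anti-derivation from $A$ into an $A$-bimodule $X$ is a linear map $d:A\to X$ with $d(ab)=d(b)a+b\,d(a)$ for all $a,b\in A$. *)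

theory Defs
  imports "HOL-Analysis.Analysis"
begin

section \<open>Complex Banach spaces\<close>

class complex_normed_vector = real_normed_vector +
  fixes scaleC :: "complex \<Rightarrow> 'a \<Rightarrow> 'a" (infixr "*\<^sub>C" 75)
  assumes scaleC_add_right: "c *\<^sub>C (x + y) = c *\<^sub>C x + c *\<^sub>C y"
    and scaleC_add_left: "(b + c) *\<^sub>C x = b *\<^sub>C x + c *\<^sub>C x"
    and scaleC_scaleC: "b *\<^sub>C c *\<^sub>C x = (b * c) *\<^sub>C x"
    and scaleR_scaleC: "r *\<^sub>R x = complex_of_real r *\<^sub>C x"
    and norm_scaleC: "norm (c *\<^sub>C x) = cmod c * norm x"

class complex_banach = complex_normed_vector + banach

lemma scaleC_one: "1 *\<^sub>C x = (x :: 'a::complex_normed_vector)"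
  using scaleR_scaleC[of 1 x] by simp

global_interpretation complex_vector:
  vector_space "scaleC :: complex \<Rightarrow> 'a \<Rightarrow> 'a::complex_normed_vector"
  defines cspan = complex_vector.span
  by unfold_locales (simp_all add: scaleC_add_right scaleC_add_left scaleC_scaleC scaleC_one)

abbreviation clinear :: "('a::complex_normed_vector \<Rightarrow> 'b::complex_normed_vector) \<Rightarrow> bool"
  where "clinear \<equiv> Vector_Spaces.linear scaleC scaleC"

definition bounded_clinear :: "('a::complex_normed_vector \<Rightarrow> 'b::complex_normed_vector) \<Rightarrow> bool"
  where "bounded_clinear f \<longleftrightarrow> clinear f \<and> bounded_linear f"

section \<open>C*-algebras\<close>

text \<open>Neither class assumes a unit.\<close>

class complex_banach_algebra = complex_banach + real_normed_algebra +
  assumes scaleC_mult_left: "(c *\<^sub>C x) * y = c *\<^sub>C (x * y)"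
    and scaleC_mult_right: "x * (c *\<^sub>C y) = c *\<^sub>C (x * y)"

class cstar_algebra = complex_banach_algebra +
  fixes star :: "'a \<Rightarrow> 'a"
  assumes star_star: "star (star x) = x"
    and star_add: "star (x + y) = star x + star y"
    and star_scaleC: "star (c *\<^sub>C x) = cnj c *\<^sub>C star x"
    and star_mult: "star (x * y) = star y * star x"
    and cstar_identity: "norm (star x * x) = (norm x)\<^sup>2"

instantiation complex :: cstar_algebra
begin

definition scaleC_complex :: "complex \<Rightarrow> complex \<Rightarrow> complex"
  where "scaleC_complex c x = c * x"

definition star_complex :: "complex \<Rightarrow> complex"
  where "star_complex x = cnj x"

instance
  by standard (simp_all add: scaleC_complex_def star_complex_def algebra_simps
      scaleR_conv_of_real norm_mult power2_eq_square)

end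

definition unital_algebra :: "'a::complex_banach_algebra itself \<Rightarrow> bool"
  where "unital_algebra _ \<longleftrightarrow> (\<exists>e::'a. \<forall>a. e * a = a \<and> a * e = a)"

definition commutator :: "'a::ring \<Rightarrow> 'a \<Rightarrow> 'a"
  where "commutator a b = a * b - b * a"

section \<open>Banach bimodules\<close>

text \<open>
  The module operations are only required to be bounded; contractive actions are the
  special case \<open>K = 1\<close>. If the algebra has a unit, it need not act as the identity.
\<close>

locale banach_bimodule =
  fixes lact :: "'a::complex_banach_algebra \<Rightarrow> 'x::complex_banach \<Rightarrow> 'x"  (infixr "\<rhd>" 75)
    and ract :: "'x \<Rightarrow> 'a \<Rightarrow> 'x"  (infixl "\<lhd>" 75)
  assumes clinear_lact_left: "clinear (\<lambda>a. a \<rhd> x)"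
    and clinear_lact_right: "clinear (\<lambda>x. a \<rhd> x)"
    and clinear_ract_left: "clinear (\<lambda>x. x \<lhd> a)"
    and clinear_ract_right: "clinear (\<lambda>a. x \<lhd> a)"
    and lact_mult: "(a * b) \<rhd> x = a \<rhd> (b \<rhd> x)"
    and ract_mult: "x \<lhd> (a * b) = (x \<lhd> a) \<lhd> b"
    and lact_ract: "(a \<rhd> x) \<lhd> b = a \<rhd> (x \<lhd> b)"
    and bounded_lact: "\<exists>K. \<forall>a x. norm (a \<rhd> x) \<le> K * norm a * norm x"
    and bounded_ract: "\<exists>K. \<forall>x a. norm (x \<lhd> a) \<le> K * norm x * norm a"

definition essential_banach_bimodule ::
    "('a::complex_banach_algebra \<Rightarrow> 'x::complex_banach \<Rightarrow> 'x) \<Rightarrow> ('x \<Rightarrow> 'a \<Rightarrow> 'x) \<Rightarrow> bool"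
  where "essential_banach_bimodule lact ract \<longleftrightarrow>
    banach_bimodule lact ract \<and>
    closure (cspan {ract (lact a x) b | a x b. True}) = UNIV"

text \<open>
  \<open>\<Phi>\<close> is the identification of the bimodule with \<open>Y\<^sup>*\<close>: a linear isometric bijection onto the
  bounded functionals on \<open>Y\<close> carrying the module operations to those of \<open>Y\<^sup>*\<close>. As types cannot
  be quantified inside a formula, the underlying Banach space \<open>'y\<close> of \<open>Y\<close> is a type parameter.
\<close>

definition dual_banach_bimodule ::
    "'y::complex_banach itself \<Rightarrow>
     ('a::complex_banach_algebra \<Rightarrow> 'x::complex_banach \<Rightarrow> 'x) \<Rightarrow> ('x \<Rightarrow> 'a \<Rightarrow> 'x) \<Rightarrow> bool"
  where "dual_banach_bimodule _ lact ract \<longleftrightarrow>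
    banach_bimodule lact ract \<and>
    (\<exists>(lactY :: 'a \<Rightarrow> 'y \<Rightarrow> 'y) (ractY :: 'y \<Rightarrow> 'a \<Rightarrow> 'y) (\<Phi> :: 'x \<Rightarrow> 'y \<Rightarrow> complex).
      banach_bimodule lactY ractY \<and>
      bij_betw \<Phi> UNIV {f. bounded_clinear f} \<and>
      (\<forall>x x' y. \<Phi> (x + x') y = \<Phi> x y + \<Phi> x' y) \<and>
      (\<forall>c x y. \<Phi> (c *\<^sub>C x) y = c * \<Phi> x y) \<and>
      (\<forall>x. onorm (\<Phi> x) = norm x) \<and>
      (\<forall>a x y. \<Phi> (lact a x) y = \<Phi> x (ractY y a)) \<and>
      (\<forall>a x y. \<Phi> (ract x a) y = \<Phi> x (lactY a y)))"

definition anti_derivation ::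
    "('a::complex_banach_algebra \<Rightarrow> 'x::complex_banach \<Rightarrow> 'x) \<Rightarrow> ('x \<Rightarrow> 'a \<Rightarrow> 'x) \<Rightarrow>
     ('a \<Rightarrow> 'x) \<Rightarrow> bool"
  where "anti_derivation lact ract d \<longleftrightarrow>
    clinear d \<and> (\<forall>a b. d (a * b) = ract (d b) a + lact b (d a))"

definition anti_derivable_at_zero ::
    "('a::complex_banach_algebra \<Rightarrow> 'x::complex_banach \<Rightarrow> 'x) \<Rightarrow> ('x \<Rightarrow> 'a \<Rightarrow> 'x) \<Rightarrow>
     ('a \<Rightarrow> 'x) \<Rightarrow> bool"
  where "anti_derivable_at_zero lact ract T \<longleftrightarrow>
    (\<forall>a b. a * b = 0 \<longrightarrow> ract (T b) a + lact b (T a) = 0)"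

end

theory Submission
  imports Defs
begin

text \<open>
  If \<open>T\<close> is anti-derivable at zero, then \<open>\<phi> a b = T b \<lhd> a + b \<rhd> T a\<close> is a bounded bilinear
  map that vanishes whenever \<open>a * b = 0\<close>. The analytic core is that on a C*-algebra such a map is
  balanced, \<open>\<phi> (a * x) b = \<phi> a (x * b)\<close> (\<open>cstar_zero_product_determined\<close>).

  It suffices to treat \<open>x = U\<close>, a unitary of the unitization, since a small selfadjoint \<open>h\<close> is
  the imaginary part of the unitary \<open>sqrt (1 - h\<^sup>2) + \<i> h\<close>. A unitary supplies zero products:
  writing \<open>c = cos\<close> for \<open>(U + U\<inverse>) / 2\<close>, the elements \<open>\<bar>c\<bar> + c\<close> and \<open>\<bar>c\<bar> - c\<close> multiply to zero,
  and \<open>\<bar>c\<bar>\<close> is available without any functional calculus, because \<open>\<bar>cos\<bar>\<close> has explicit absolutely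
  summable Fourier coefficients. The same holds for every rotation \<open>z U\<close> with \<open>\<bar>z\<bar> = 1\<close>, so all
  Fourier coefficients in \<open>z\<close> of the resulting relation vanish. One of them says, with \<open>U\<close> acting
  as \<open>r\<close> in the first and as \<open>l\<close> in the second argument of \<open>\<phi>\<close>, that \<open>(r - l)\<^sup>3\<close> annihilates
  \<open>\<phi>\<close>. Thus the sequence \<open>\<phi> (a U^n) (U^(-n) b)\<close> is bounded and has vanishing third differences;
  it is constant, and \<open>\<phi> (a U) b = \<phi> a (U b)\<close>.

  The balance identity reads \<open>T b \<lhd> (a * x) + b \<rhd> T (a * x) = T (x * b) \<lhd> a + (x * b) \<rhd> T a\<close>.
  Letting \<open>a\<close> or \<open>b\<close> run through an approximate identity produces \<open>\<xi>\<close>: it is the value of \<open>T\<close> at the unit,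
  or a weak* cluster point of \<open>T\<close> along the approximate identity if \<open>X\<close> is a dual module. It
  commutes with \<open>A\<close> and satisfies \<open>T (a * b) = b \<rhd> T a + T b \<lhd> a - \<xi> \<lhd> (a * b)\<close>.

  All that is left is \<open>\<xi> [a, b] = 0\<close>, for then \<open>\<xi> \<lhd> (a * b) = (b \<rhd> \<xi>) \<lhd> a\<close>. Put
  \<open>d = T - \<xi>\<close>; associativity of the product gives \<open>d c \<lhd> [a, c] = 0\<close>, and evaluating
  \<open>d (a * b) \<lhd> [a, b]\<close> in two ways gives \<open>\<xi> [a, b]\<^sup>2 = 0\<close>
  (\<open>annihilates_commutator_square\<close>). For selfadjoint \<open>a\<close>, \<open>b\<close> the element \<open>\<i> [a, b]\<close> is selfadjoint,
  and a selfadjoint \<open>h\<close> is a limit of elements \<open>h e\<close> with \<open>e\<close> in the right ideal generated by \<open>h\<^sup>2\<close>, so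
  that \<open>\<xi> h\<^sup>2 = 0\<close> forces \<open>\<xi> h = 0\<close>.
\<close>

section \<open>The Fourier coefficients of the absolute value of the cosine\<close>

definition odd_recip :: "int \<Rightarrow> real"
  where "odd_recip j = 1 / of_int (2 * j + 1)"

lemma odd_recip_nz: "real_of_int (2 * j + 1) \<noteq> 0"
  by presburger

lemma odd_recip_reflect: "odd_recip (- 1 - j) = - odd_recip j"
proof -
  have "real_of_int (2 * (- 1 - j) + 1) = - real_of_int (2 * j + 1)"
    by simp
  then show ?thesis
    unfolding odd_recip_def by (simp only: divide_minus_right)
qed

lemma has_sum_int_halves:
  fixes f :: "int \<Rightarrow> 'a::real_normed_vector"
  assumes "((\<lambda>n::nat. f (int n)) has_sum s) UNIV" "((\<lambda>n::nat. f (- 1 - int n)) has_sum t) UNIV"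
  shows "(f has_sum (s + t)) UNIV"
proof -
  have b1: "bij_betw int UNIV {0..}"
    by (rule bij_betwI[where g = nat]) auto
  have b2: "bij_betw (\<lambda>n. - 1 - int n) UNIV {..<0}"
    by (rule bij_betwI[where g = "\<lambda>j. nat (- 1 - j)"]) auto
  have "(f has_sum s) {0..}" "(f has_sum t) {..<0}"
    using assms has_sum_reindex_bij_betw[OF b1, of f s] has_sum_reindex_bij_betw[OF b2, of f t]
    by auto
  then have "(f has_sum (s + t)) ({0..} \<union> {..<0})"
    by (rule has_sum_Un_disjoint) auto
  moreover have "{0..} \<union> {..<0} = (UNIV :: int set)"
    by auto
  ultimately show ?thesis by simp
qed

lemma has_sum_int_shift:
  fixes f :: "int \<Rightarrow> 'a::real_normed_vector"
  shows "((\<lambda>j. f (j + k)) has_sum s) UNIV \<longleftrightarrow> (f has_sum s) UNIV"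
  by (rule has_sum_reindex_bij_betw) (rule bij_betwI[where g = "\<lambda>j. j - k"], auto)

text \<open>
  Euler's sum over the odd squares, once for each sign: the even terms of \<open>\<Sum> 1 / n\<^sup>2 = \<pi>\<^sup>2 / 6\<close> contribute
  a quarter of it.
\<close>

lemma has_sum_odd_recip_sq: "((\<lambda>j. odd_recip j * odd_recip j) has_sum (pi\<^sup>2 / 4)) UNIV"
proof -
  define f :: "nat \<Rightarrow> real" where "f n = 1 / (real n + 1)\<^sup>2" for n
  have all: "(f has_sum (pi\<^sup>2 / 6)) UNIV"
    unfolding f_def by (rule sums_nonneg_imp_has_sum) (use inverse_squares_sums in \<open>auto simp: add.commute\<close>)
  have b: "bij_betw (\<lambda>n::nat. 2 * n + 1) UNIV {n. odd n}"
    by (rule bij_betwI[where g = "\<lambda>n. n div 2"]) auto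
  have "((\<lambda>n. 1/4 * f n) has_sum (1/4 * (pi\<^sup>2 / 6))) UNIV"
    using all by (rule has_sum_cmult_right)
  moreover have "(\<lambda>n. 1/4 * f n) = (\<lambda>n. f (2 * n + 1))"
  proof
    fix n
    have "(real (2 * n + 1) + 1)\<^sup>2 = 4 * (real n + 1)\<^sup>2"
      by (simp add: power2_eq_square algebra_simps)
    then show "1/4 * f n = f (2 * n + 1)" by (simp add: f_def)
  qed
  ultimately have "(f has_sum (1/4 * (pi\<^sup>2 / 6))) {n. odd n}"
    by (simp only: has_sum_reindex_bij_betw[OF b, of f])
  from has_sum_Diff[OF all this] have "(f has_sum (pi\<^sup>2 / 8)) (UNIV - {n. odd n})"
    by simp
  moreover have "UNIV - {n :: nat. odd n} = {n. even n}"
    by auto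
  ultimately have ev: "(f has_sum (pi\<^sup>2 / 8)) {n. even n}"
    by simp
  have b': "bij_betw (\<lambda>n::nat. 2 * n) UNIV {n. even n}"
    by (rule bij_betwI[where g = "\<lambda>n. n div 2"]) auto
  have half: "((\<lambda>n::nat. odd_recip (int n) * odd_recip (int n)) has_sum (pi\<^sup>2 / 8)) UNIV"
    using ev has_sum_reindex_bij_betw[OF b', of f]
    by (simp add: f_def odd_recip_def power2_eq_square add.commute)
  have "((\<lambda>n. odd_recip (- 1 - int n) * odd_recip (- 1 - int n)) has_sum (pi\<^sup>2 / 8)) UNIV"
    using half by (simp add: odd_recip_reflect)
  from has_sum_int_halves[OF half this] show ?thesis
    by simp
qed

text \<open>
  A telescoping sum; absolute summability comes from the constant sign of the terms on
  \<open>j > 0\<close> and on \<open>j < 0\<close>.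
\<close>

lemma has_sum_odd_recip_step: "((\<lambda>j. odd_recip j - odd_recip (j - 1)) has_sum 0) UNIV"
proof -
  define e :: "nat \<Rightarrow> real" where "e n = odd_recip (int n) - odd_recip (int (Suc n))" for n
  have lim: "(\<lambda>n. odd_recip (int n)) \<longlonglongrightarrow> 0"
    using LIMSEQ_subseq_LIMSEQ[OF lim_1_over_n[where 'a = real], of "\<lambda>n. 2 * n + 1"]
    by (simp add: odd_recip_def strict_mono_def o_def add.commute)
  have "(\<lambda>n. odd_recip (int n) - odd_recip (int (Suc n))) sums (odd_recip (int 0) - 0)"
    by (rule telescope_sums'[OF lim])
  moreover have "0 \<le> e n" for n
    by (simp add: e_def odd_recip_def frac_le)
  ultimately have e: "(e has_sum 1) UNIV"
    using sums_nonneg_imp_has_sum[of e 1] by (simp add: e_def[abs_def] odd_recip_def)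
  define f :: "int \<Rightarrow> real" where "f j = odd_recip j - odd_recip (j - 1)" for j
  have neg: "((\<lambda>n. f (- 1 - int n)) has_sum - 1) UNIV"
  proof -
    have "f (- 1 - int n) = - e n" for n
      using odd_recip_reflect[of "int n"] odd_recip_reflect[of "int (Suc n)"]
      by (simp add: f_def e_def algebra_simps)
    then show ?thesis
      using has_sum_uminusI[OF e] by simp
  qed
  have pos: "((\<lambda>n. f (int n)) has_sum 1) UNIV"
  proof -
    have b: "bij_betw Suc UNIV {n. n \<noteq> 0}"
      by (rule bij_betwI[where g = "\<lambda>n. n - 1"]) auto
    have "f (int (Suc n)) = - e n" for n
      by (simp add: f_def e_def)
    then have "((\<lambda>n. f (int (Suc n))) has_sum - 1) UNIV"
      using has_sum_uminusI[OF e] by simp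
    then have "((\<lambda>n. f (int n)) has_sum - 1) {n. n \<noteq> 0}"
      by (simp only: has_sum_reindex_bij_betw[OF b, of "\<lambda>n. f (int n)"])
    then have "((\<lambda>n. f (int n)) has_sum (f (int 0) + - 1)) (insert 0 {n. n \<noteq> 0})"
      by (intro has_sum_insert) auto
    moreover have "insert 0 {n. n \<noteq> 0} = (UNIV :: nat set)"
      by auto
    moreover have "f (int 0) + - 1 = 1"
      by (simp add: f_def odd_recip_def)
    ultimately show ?thesis by simp
  qed
  show ?thesis
    using has_sum_int_halves[OF pos neg] by (simp add: f_def)
qed

lemma has_sum_odd_recip_diff_nat:
  "((\<lambda>j. odd_recip j - odd_recip (j - int p)) has_sum 0) UNIV"
proof (induction p)
  case (Suc p)
  have "((\<lambda>j. odd_recip (j - int p) - odd_recip (j - int p - 1)) has_sum 0) UNIV"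
    using has_sum_odd_recip_step has_sum_int_shift[of "\<lambda>j. odd_recip j - odd_recip (j - 1)" "- int p" 0]
    by simp
  from has_sum_add[OF Suc this] show ?case
    by (simp add: algebra_simps)
qed (simp add: has_sum_0)

lemma has_sum_odd_recip_diff:
  "((\<lambda>j. odd_recip j - odd_recip (j - p)) has_sum 0) UNIV"
proof (cases "0 \<le> p")
  case True
  then show ?thesis using has_sum_odd_recip_diff_nat[of "nat p"] by simp
next
  case False
  then have "((\<lambda>j. odd_recip j - odd_recip (j + p)) has_sum 0) UNIV"
    using has_sum_odd_recip_diff_nat[of "nat (- p)"] by simp
  then have "((\<lambda>j. odd_recip (j - p) - odd_recip j) has_sum 0) UNIV"
    using has_sum_int_shift[of "\<lambda>j. odd_recip j - odd_recip (j + p)" "- p" 0] by simp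
  from has_sum_uminusI[OF this] show ?thesis by simp
qed

text \<open>
  The two indices \<open>2 * j + 1\<close> and \<open>2 * (p - 1 - j) + 1\<close> add up to \<open>2 * p\<close>. If \<open>p \<noteq> 0\<close>, partial
  fractions turn the product of the reciprocals into a multiple of \<open>odd_recip j - odd_recip (j - p)\<close>,
  whose sum telescopes to zero.
\<close>

lemma has_sum_odd_recip_conv:
  "((\<lambda>j. odd_recip j * odd_recip (p - 1 - j)) has_sum (if p = 0 then - pi\<^sup>2 / 4 else 0)) UNIV"
proof (cases "p = 0")
  case True
  then show ?thesis
    using has_sum_uminusI[OF has_sum_odd_recip_sq] by (simp add: odd_recip_reflect)
next
  case False
  have "odd_recip j * odd_recip (p - 1 - j) = 1 / (2 * of_int p) * (odd_recip j - odd_recip (j - p))" for j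
  proof -
    have "odd_recip (p - 1 - j) = - odd_recip (j - p)"
      using odd_recip_reflect[of "j - p"] by (simp add: algebra_simps)
    moreover have "odd_recip j - odd_recip (j - p) = - 2 * of_int p * (odd_recip j * odd_recip (j - p))"
      using odd_recip_nz[of j] odd_recip_nz[of "j - p"]
      by (simp add: odd_recip_def field_simps)
    ultimately show ?thesis using False by simp
  qed
  then show ?thesis
    using has_sum_cmult_right[OF has_sum_odd_recip_diff[of p], of "1 / (2 * of_int p)"] False by simp
qed

text \<open>
  The number \<open>(- 1) ^ j / (1 - 4 * j\<^sup>2)\<close>, which is \<open>\<pi> / 2\<close> times the coefficient of
  \<open>exp (2 \<i> j \<theta>)\<close> in \<open>\<bar>cos \<theta>\<bar>\<close>; written as a difference of reciprocals it makes the convolution square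
  accessible to \<open>has_sum_odd_recip_conv\<close>.
\<close>

definition abscos_coeff :: "int \<Rightarrow> real"
  where "abscos_coeff j = (- 1) powi j / 2 * (odd_recip j - odd_recip (j - 1))"

lemma abscos_coeff_0: "abscos_coeff 0 = 1"
  by (simp add: abscos_coeff_def odd_recip_def)

lemma abscos_coeff_1: "abscos_coeff 1 = 1 / 3"
  by (simp add: abscos_coeff_def odd_recip_def)

lemma abscos_coeff_abs_summable: "(\<lambda>j. \<bar>abscos_coeff j\<bar>) summable_on UNIV"
proof -
  have "(\<lambda>j. norm (odd_recip j - odd_recip (j - 1))) summable_on UNIV"
    by (rule summable_on_iff_abs_summable_on_real[THEN iffD1, OF has_sum_imp_summable[OF has_sum_odd_recip_step]])
  then have "(\<lambda>j. 1/2 * norm (odd_recip j - odd_recip (j - 1))) summable_on UNIV"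
    by (rule summable_on_cmult_right)
  moreover have "(\<lambda>j. \<bar>abscos_coeff j\<bar>) = (\<lambda>j. 1/2 * norm (odd_recip j - odd_recip (j - 1)))"
  proof
    fix j
    show "\<bar>abscos_coeff j\<bar> = 1/2 * norm (odd_recip j - odd_recip (j - 1))"
      using norm_power_int[of "- 1 :: real" j] by (simp add: abscos_coeff_def abs_mult)
  qed
  ultimately show ?thesis
    by (simp only:)
qed

text \<open>
  The right-hand side lists the coefficients of \<open>(\<pi> / 2 * cos \<theta>)\<^sup>2\<close>, so this is the identity
  \<open>\<bar>cos\<bar>\<^sup>2 = cos\<^sup>2\<close> at the level of Fourier coefficients.
\<close>

lemma has_sum_abscos_coeff_conv:
  "((\<lambda>i. abscos_coeff i * abscos_coeff (k - i)) has_sum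
     (if k = 0 then pi\<^sup>2 / 8 else if \<bar>k\<bar> = 1 then pi\<^sup>2 / 16 else 0)) UNIV"
proof -
  define h where "h p = (if p = 0 then - pi\<^sup>2 / 4 else (0::real))" for p :: int
  define H where "H p j = odd_recip j * odd_recip (p - 1 - j)" for p j
  have H: "(H p has_sum h p) UNIV" for p
    unfolding H_def h_def by (rule has_sum_odd_recip_conv)
  have H': "((\<lambda>j. H p (j + - 1)) has_sum h p) UNIV" for p
    unfolding has_sum_int_shift by (rule H)
  have "((\<lambda>j. (H (k + 1) j + - H k j) + (- H k (j + - 1) + H (k - 1) (j + - 1))) has_sum
      ((h (k + 1) + - h k) + (- h k + h (k - 1)))) UNIV"
    by (intro has_sum_add has_sum_uminusI H H')
  from has_sum_cmult_right[OF this, of "(- 1) powi k / 4"]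
  have "((\<lambda>j. abscos_coeff j * abscos_coeff (k - j)) has_sum
      ((- 1) powi k / 4 * ((h (k + 1) + - h k) + (- h k + h (k - 1))))) UNIV"
  proof (rule has_sum_cong[THEN iffD1, rotated])
    fix j :: int
    have pw: "(- 1 :: real) powi k = (- 1) powi j * (- 1) powi (k - j)"
      by (subst power_int_add[symmetric]) auto
    have gen: "u * v / 4 * ((a * b + - (a * c)) + (- (d * b) + d * c)) = (u / 2 * (a - d)) * (v / 2 * (b - c))"
      for u v a b c d :: real
      by (simp add: field_simps)
    have idx: "k + 1 - 1 - j = k - j" "k - 1 - j = k - j - 1" "j + - 1 = j - 1" "k - 1 - (j - 1) = k - j"
      "k - 1 - 1 - (j - 1) = k - j - 1"
      by auto
    show "(- 1) powi k / 4 * ((H (k + 1) j + - H k j) + (- H k (j + - 1) + H (k - 1) (j + - 1))) =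
      abscos_coeff j * abscos_coeff (k - j)"
      unfolding abscos_coeff_def H_def idx pw by (rule gen)
  qed
  moreover have "(- 1) powi k / 4 * ((h (k + 1) + - h k) + (- h k + h (k - 1))) =
      (if k = 0 then pi\<^sup>2 / 8 else if \<bar>k\<bar> = 1 then pi\<^sup>2 / 16 else 0)"
  proof -
    consider "k = 0" | "k = 1" | "k = - 1" | "k \<notin> {-1, 0, 1}"
      by auto
    then show ?thesis
    proof cases
      case 4
      then have "k \<noteq> 0" "\<bar>k\<bar> \<noteq> 1" "k + 1 \<noteq> 0" "k - 1 \<noteq> 0"
        by auto
      then show ?thesis
        by (simp only: h_def if_False) simp
    qed (simp_all add: h_def)
  qed
  ultimately show ?thesis by simp
qed

section \<open>Fourier coefficients and isometry groups\<close>

lemma bounded_linear_scaleC: "bounded_linear (\<lambda>x :: 'a::complex_normed_vector. c *\<^sub>C x)"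
  by (rule bounded_linear_intro[where K = "cmod c"])
    (simp_all add: scaleC_add_right scaleR_scaleC scaleC_scaleC norm_scaleC mult.commute)

lemma geometric_root_of_unity_sum:
  fixes N :: nat and j :: int
  assumes "\<bar>j\<bar> < int N"
  shows "(\<Sum>l<N. cis (2 * pi * real l / real N) powi j) = (if j = 0 then of_nat N else 0)"
proof (cases "j = 0")
  case False
  define z where "z = cis (2 * pi * of_int j / real N)"
  have N: "N > 0" using assms by auto
  have pw: "cis (2 * pi * real l / real N) powi j = z ^ l" for l
    unfolding z_def cis_power_int Complex.DeMoivre by (simp add: field_simps)
  have "z \<noteq> 1"
  proof
    assume "z = 1"
    then have "cos (2 * pi * of_int j / real N) = 1"
      by (simp add: z_def cis_conv_exp complex_eq_iff Re_exp)
    then obtain n :: int where "2 * pi * of_int j / real N = of_int n * 2 * pi"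
      by (auto simp: cos_one_2pi_int)
    then have "of_int j = (of_int n * of_nat N :: real)"
      using N by (simp add: field_simps)
    then have j: "j = n * int N"
      by (metis of_int_eq_iff of_int_mult of_int_of_nat_eq)
    with False have "n \<noteq> 0" by auto
    then have "int N \<le> \<bar>j\<bar>"
      by (simp add: j abs_mult mult_le_cancel_right1) (use \<open>n \<noteq> 0\<close> in auto)
    with assms show False by simp
  qed
  moreover have "z ^ N = 1"
    using N unfolding z_def Complex.DeMoivre by (simp add: cis_multiple_2pi mult.assoc[symmetric])
  ultimately have "(\<Sum>l<N. z ^ l) = 0"
    by (simp add: geometric_sum)
  then show ?thesis using False by (simp only: pw if_False)
qed simp

text \<open>
  Averaging over the \<open>N\<close>-th roots of unity singles out the coefficient at \<open>0\<close> from any finite set of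
  frequencies of modulus below \<open>N\<close>; the remaining frequencies have small total norm.
\<close>

lemma fourier_coefficient_zero:
  fixes D :: "int \<Rightarrow> 'x::complex_banach"
  assumes summable: "(\<lambda>j. norm (D j)) summable_on UNIV"
    and zero: "\<And>z. cmod z = 1 \<Longrightarrow> ((\<lambda>j. z powi j *\<^sub>C D j) has_sum 0) UNIV"
  shows "D 0 = 0"
proof -
  define S where "S = (\<Sum>\<^sub>\<infinity>j. norm (D j))"
  have S: "((\<lambda>j. norm (D j)) has_sum S) UNIV"
    unfolding S_def using summable by (rule has_sum_infsum)
  have "norm (D 0) \<le> 0 + e" if "e > 0" for e
  proof -
    obtain F0 where F0: "finite F0" "dist (sum (\<lambda>j. norm (D j)) F0) S \<le> e"
      using has_sum_finite_approximation[OF S \<open>e > 0\<close>] by auto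
    define F where "F = insert 0 F0"
    have F: "finite F" "0 \<in> F" "F0 \<subseteq> F" using F0 by (auto simp: F_def)
    have "S \<le> sum (\<lambda>j. norm (D j)) F0 + e"
      using F0(2) by (simp add: dist_real_def abs_le_iff)
    also have "sum (\<lambda>j. norm (D j)) F0 \<le> sum (\<lambda>j. norm (D j)) F"
      using F by (intro sum_mono2) auto
    finally have tail: "S - sum (\<lambda>j. norm (D j)) F \<le> e" by simp
    have partial: "norm (\<Sum>j\<in>F. z powi j *\<^sub>C D j) \<le> e" if z: "cmod z = 1" for z
    proof -
      have "((\<lambda>j. z powi j *\<^sub>C D j) has_sum (0 - (\<Sum>j\<in>F. z powi j *\<^sub>C D j))) (UNIV - F)"
        using zero[OF z] has_sum_finite[OF F(1)] by (rule has_sum_Diff) auto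
      moreover have "((\<lambda>j. norm (D j)) has_sum (S - sum (\<lambda>j. norm (D j)) F)) (UNIV - F)"
        using S has_sum_finite[OF F(1)] by (rule has_sum_Diff) auto
      ultimately have "norm (0 - (\<Sum>j\<in>F. z powi j *\<^sub>C D j)) \<le> S - sum (\<lambda>j. norm (D j)) F"
        by (rule norm_infsum_le) (simp add: norm_scaleC norm_power_int z)
      then show ?thesis using tail by simp
    qed
    define N where "N = Suc (\<Sum>j\<in>F. nat \<bar>j\<bar>)"
    have N: "\<bar>j\<bar> < int N" if "j \<in> F" for j
    proof -
      have "nat \<bar>j\<bar> \<le> (\<Sum>j\<in>F. nat \<bar>j\<bar>)"
        using F(1) that by (intro member_le_sum) auto
      then show ?thesis unfolding N_def by linarith
    qed
    define w where "w l = cis (2 * pi * real l / real N)" for l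
    have "(\<Sum>l<N. \<Sum>j\<in>F. w l powi j *\<^sub>C D j) = (\<Sum>j\<in>F. (\<Sum>l<N. w l powi j) *\<^sub>C D j)"
      by (subst sum.swap) (simp add: complex_vector.scale_sum_left)
    also have "\<dots> = (\<Sum>j\<in>F. (if j = 0 then of_nat N else 0) *\<^sub>C D j)"
      unfolding w_def by (intro sum.cong refl arg_cong2[where f = scaleC] geometric_root_of_unity_sum N)
    also have "\<dots> = (\<Sum>j\<in>F. if j = 0 then of_nat N *\<^sub>C D j else 0)"
      by (intro sum.cong) auto
    also have "\<dots> = of_nat N *\<^sub>C D 0"
      using F by simp
    finally have "of_nat N *\<^sub>C D 0 = (\<Sum>l<N. \<Sum>j\<in>F. w l powi j *\<^sub>C D j)" ..
    then have "real N * norm (D 0) = norm (\<Sum>l<N. \<Sum>j\<in>F. w l powi j *\<^sub>C D j)"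
      by (metis norm_scaleC norm_of_nat)
    also have "\<dots> \<le> (\<Sum>l<N. e)"
      by (rule sum_norm_le) (simp add: partial w_def)
    finally have "real N * norm (D 0) \<le> real N * e" by simp
    moreover have "real N > 0"
      by (simp only: N_def of_nat_0_less_iff zero_less_Suc)
    ultimately show ?thesis by simp
  qed
  then have "norm (D 0) \<le> 0" by (rule field_le_epsilon)
  then show ?thesis by simp
qed

text \<open>
  The powers \<open>W n = U\<^sup>n\<close> of a surjective linear isometry \<open>U\<close>, which takes the place of
  \<open>exp (\<i> \<theta>)\<close>.
\<close>

locale isometry_group =
  fixes W :: "int \<Rightarrow> 'a::complex_banach \<Rightarrow> 'a"
  assumes W_0: "W 0 x = x"
    and W_add: "W (m + n) x = W m (W n x)"
    and W_plus: "W n (x + y) = W n x + W n y"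
    and W_scaleC: "W n (c *\<^sub>C x) = c *\<^sub>C W n x"
    and W_norm: "norm (W n x) = norm x"
begin

lemma bounded_linear_W: "bounded_linear (W n)"
  by (rule bounded_linear_intro[where K = 1]) (simp_all add: W_plus W_norm scaleR_scaleC W_scaleC)

lemma rotate:
  assumes "cmod z = 1"
  shows "isometry_group (\<lambda>n x. z powi n *\<^sub>C W n x)"
proof
  have z: "z \<noteq> 0" using assms by auto
  show "z powi (m + n) *\<^sub>C W (m + n) x = z powi m *\<^sub>C W m (z powi n *\<^sub>C W n x)" for m n x
    by (simp add: power_int_add z W_add W_scaleC scaleC_scaleC)
  show "norm (z powi n *\<^sub>C W n x) = norm x" for n x
    by (simp add: norm_scaleC norm_power_int assms W_norm)
qed (simp_all add: W_0 W_plus W_scaleC scaleC_one scaleC_add_right scaleC_scaleC mult.commute)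

text \<open>
  Both \<open>cosine\<close> and \<open>abs_cosine\<close> carry the factor \<open>\<pi> / 2\<close> built into \<open>abscos_coeff\<close>.
\<close>

definition cosine :: "'a \<Rightarrow> 'a"
  where "cosine x = (pi / 4) *\<^sub>R (W 1 x + W (- 1) x)"

definition abs_cosine :: "'a \<Rightarrow> 'a"
  where "abs_cosine x = (\<Sum>\<^sub>\<infinity>j. abscos_coeff j *\<^sub>R W (2 * j) x)"

lemma abs_cosine_has_sum: "((\<lambda>j. abscos_coeff j *\<^sub>R W (2 * j) x) has_sum abs_cosine x) UNIV"
proof -
  have "(\<lambda>j. norm (abscos_coeff j *\<^sub>R W (2 * j) x)) summable_on UNIV"
    unfolding norm_scaleR W_norm by (rule summable_on_cmult_left[OF abscos_coeff_abs_summable])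
  then show ?thesis
    unfolding abs_cosine_def by (rule has_sum_infsum[OF abs_summable_summable])
qed

lemma abs_cosine_plus: "abs_cosine (x + y) = abs_cosine x + abs_cosine y"
proof (rule has_sum_unique[OF abs_cosine_has_sum])
  show "((\<lambda>j. abscos_coeff j *\<^sub>R W (2 * j) (x + y)) has_sum (abs_cosine x + abs_cosine y)) UNIV"
    using has_sum_add[OF abs_cosine_has_sum abs_cosine_has_sum, of x y]
    by (simp add: W_plus scaleR_add_right)
qed

lemma abs_cosine_W: "abs_cosine (W n x) = W n (abs_cosine x)"
proof (rule has_sum_unique[OF abs_cosine_has_sum])
  show "((\<lambda>j. abscos_coeff j *\<^sub>R W (2 * j) (W n x)) has_sum W n (abs_cosine x)) UNIV"
    using has_sum_bounded_linear[OF bounded_linear_W abs_cosine_has_sum, of n x]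
    by (simp add: linear_simps[OF bounded_linear_W] W_add[symmetric] add.commute)
qed

lemma abs_cosine_scaleR: "abs_cosine (r *\<^sub>R x) = r *\<^sub>R abs_cosine x"
proof (rule has_sum_unique[OF abs_cosine_has_sum])
  show "((\<lambda>j. abscos_coeff j *\<^sub>R W (2 * j) (r *\<^sub>R x)) has_sum r *\<^sub>R abs_cosine x) UNIV"
    using has_sum_bounded_linear[OF bounded_linear_scaleR_right abs_cosine_has_sum, of r x]
    by (simp add: linear_simps[OF bounded_linear_W] mult.commute)
qed

lemma abs_cosine_cosine: "abs_cosine (cosine x) = cosine (abs_cosine x)"
  by (simp add: cosine_def abs_cosine_scaleR abs_cosine_plus abs_cosine_W)

lemma cosine_plus: "cosine (x + y) = cosine x + cosine y"
  by (simp add: cosine_def W_plus scaleR_add_right)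

text \<open>
  Multiplying out the absolutely convergent series gives the convolution square of \<open>abscos_coeff\<close>
  as coefficients of the even powers of \<open>U\<close>.
\<close>

lemma abs_cosine_square: "abs_cosine (abs_cosine x) = cosine (cosine x)"
proof -
  define b where "b k = (if k = 0 then pi\<^sup>2 / 8 else if \<bar>k\<bar> = 1 then pi\<^sup>2 / 16 else 0)" for k :: int
  define f where "f = (\<lambda>(i, k). (abscos_coeff i * abscos_coeff (k - i)) *\<^sub>R W (2 * k) x)"
  define S where "S = (\<Sum>\<^sub>\<infinity>j. \<bar>abscos_coeff j\<bar>)"
  have S: "((\<lambda>j. \<bar>abscos_coeff j\<bar>) has_sum S) UNIV"
    unfolding S_def using abscos_coeff_abs_summable by (rule has_sum_infsum)
  have abs_row: "((\<lambda>k. norm (f (i, k))) has_sum (\<bar>abscos_coeff i\<bar> * S * norm x)) UNIV" for i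
    using has_sum_int_shift[THEN iffD2, OF S, of "- i",
        THEN has_sum_cmult_right, of "\<bar>abscos_coeff i\<bar>", THEN has_sum_cmult_left, of "norm x"]
    by (simp add: f_def W_norm abs_mult)
  have "(\<lambda>p. norm (f p)) summable_on (UNIV \<times> UNIV)"
    unfolding Infinite_Sum.abs_summable_on_Sigma_iff
  proof (intro conjI ballI)
    show "(\<lambda>k. norm (f (i, k))) summable_on UNIV" for i
      using abs_row by (rule has_sum_imp_summable)
    have "(\<lambda>i. norm (\<Sum>\<^sub>\<infinity>k. norm (f (i, k)))) = (\<lambda>i. \<bar>abscos_coeff i\<bar> * (\<bar>S\<bar> * norm x))"
      by (simp add: infsumI[OF abs_row] abs_mult mult.assoc)
    then show "(\<lambda>i. norm (\<Sum>\<^sub>\<infinity>k. norm (f (i, k)))) summable_on UNIV"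
      by (simp only: summable_on_cmult_left[OF abscos_coeff_abs_summable])
  qed
  then have f: "f summable_on (UNIV \<times> UNIV)"
    by (rule abs_summable_summable)
  have "((\<lambda>k. f (i, k)) has_sum (abscos_coeff i *\<^sub>R W (2 * i) (abs_cosine x))) UNIV" for i
  proof -
    have "((\<lambda>j. abscos_coeff i *\<^sub>R W (2 * i) (abscos_coeff j *\<^sub>R W (2 * j) x)) has_sum
        (abscos_coeff i *\<^sub>R W (2 * i) (abs_cosine x))) UNIV"
      by (intro has_sum_bounded_linear[OF bounded_linear_scaleR_right]
          has_sum_bounded_linear[OF bounded_linear_W] abs_cosine_has_sum)
    from has_sum_int_shift[THEN iffD2, OF this, of "- i"] show ?thesis
      by (simp add: f_def linear_simps[OF bounded_linear_W] W_add[symmetric] algebra_simps)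
  qed
  then have "(f has_sum abs_cosine (abs_cosine x)) (UNIV \<times> UNIV)"
    by (rule has_sum_SigmaI[OF _ abs_cosine_has_sum f])
  then have sw: "((\<lambda>(k, i). f (i, k)) has_sum abs_cosine (abs_cosine x)) (UNIV \<times> UNIV)"
    by (rule has_sum_swap[THEN iffD1])
  have col: "((\<lambda>i. (\<lambda>(k, i). f (i, k)) (k, i)) has_sum (b k *\<^sub>R W (2 * k) x)) UNIV" for k
    using has_sum_bounded_linear[OF bounded_linear_scaleR_left[of "W (2 * k) x"] has_sum_abscos_coeff_conv[of k]]
    by (simp add: f_def b_def)
  have "((\<lambda>k. b k *\<^sub>R W (2 * k) x) has_sum abs_cosine (abs_cosine x)) UNIV"
    by (rule has_sum_SigmaD[OF sw col])
  moreover have "((\<lambda>k. b k *\<^sub>R W (2 * k) x) has_sum (\<Sum>k\<in>{-1, 0, 1}. b k *\<^sub>R W (2 * k) x)) UNIV"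
  proof (rule has_sum_finite_neutralI)
    fix k :: int
    assume "k \<in> UNIV - {-1, 0, 1}"
    then have "k \<noteq> 0" "\<bar>k\<bar> \<noteq> 1" by auto
    then show "b k *\<^sub>R W (2 * k) x = 0" by (simp add: b_def)
  qed auto
  ultimately have "abs_cosine (abs_cosine x) = (\<Sum>k\<in>{-1, 0, 1}. b k *\<^sub>R W (2 * k) x)"
    by (rule has_sum_unique)
  also have "\<dots> = (pi\<^sup>2 / 16) *\<^sub>R W (- 2) x + (pi\<^sup>2 / 8) *\<^sub>R x + (pi\<^sup>2 / 16) *\<^sub>R W 2 x"
    by (simp add: b_def W_0)
  also have "(pi\<^sup>2 / 8) *\<^sub>R x = (pi\<^sup>2 / 16) *\<^sub>R x + (pi\<^sup>2 / 16) *\<^sub>R x"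
    unfolding scaleR_add_left[symmetric] by (rule arg_cong2[where f = scaleR]) auto
  also have "(pi\<^sup>2 / 16) *\<^sub>R W (- 2) x + ((pi\<^sup>2 / 16) *\<^sub>R x + (pi\<^sup>2 / 16) *\<^sub>R x)
      + (pi\<^sup>2 / 16) *\<^sub>R W 2 x = cosine (cosine x)"
    by (simp add: cosine_def linear_simps[OF bounded_linear_W] W_add[symmetric] W_0
        scaleR_add_right power2_eq_square add_ac)
  finally show ?thesis .
qed

text \<open>
  The operator forms of \<open>(\<bar>cos\<bar> + cos) * (\<bar>cos\<bar> - cos) = 0\<close>: the source of all zero products below.
\<close>

lemma abs_cosine_factor: "cosine (abs_cosine x - cosine x) + abs_cosine (abs_cosine x - cosine x) = 0"
  and abs_cosine_factor': "abs_cosine (abs_cosine x + cosine x) - cosine (abs_cosine x + cosine x) = 0"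
proof -
  have m: "cosine (u - v) = cosine u - cosine v" "abs_cosine (u - v) = abs_cosine u - abs_cosine v" for u v
    using cosine_plus[of "u - v" v] abs_cosine_plus[of "u - v" v] by (simp_all add: algebra_simps)
  show "cosine (abs_cosine x - cosine x) + abs_cosine (abs_cosine x - cosine x) = 0"
    "abs_cosine (abs_cosine x + cosine x) - cosine (abs_cosine x + cosine x) = 0"
    by (simp_all add: m cosine_plus abs_cosine_plus abs_cosine_square abs_cosine_cosine)
qed

end


section \<open>Bilinear maps that vanish on zero products\<close>

locale zero_product_form =
  fixes \<phi> :: "'a::complex_banach_algebra \<Rightarrow> 'a \<Rightarrow> 'x::complex_banach"
  assumes bilinear: "bounded_bilinear \<phi>"
    and scaleC_left: "\<phi> (c *\<^sub>C a) b = c *\<^sub>C \<phi> a b"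
    and scaleC_right: "\<phi> a (c *\<^sub>C b) = c *\<^sub>C \<phi> a b"
    and zero_product: "a * b = 0 \<Longrightarrow> \<phi> a b = 0"
begin

lemmas form_linear_simps =
  bounded_bilinear.add_left[OF bilinear] bounded_bilinear.add_right[OF bilinear]
  bounded_bilinear.diff_left[OF bilinear] bounded_bilinear.diff_right[OF bilinear]
  bounded_bilinear.scaleR_left[OF bilinear] bounded_bilinear.scaleR_right[OF bilinear]

end

text \<open>
  The model is right multiplication \<open>R\<close> and left multiplication \<open>L\<close> by the powers of one unitary
  multiplier; these act on the two arguments of \<open>\<phi>\<close>.
\<close>

locale balanced_isometry_groups = R: isometry_group R + L: isometry_group L + zero_product_form \<phi>
  for R L :: "int \<Rightarrow> 'a::complex_banach_algebra \<Rightarrow> 'a" and \<phi> :: "'a \<Rightarrow> 'a \<Rightarrow> 'x::complex_banach" +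
  assumes balanced: "R n a * b = a * L n b"
begin

lemma rotate_balanced:
  assumes "cmod z = 1"
  shows "balanced_isometry_groups (\<lambda>n x. z powi n *\<^sub>C R n x) (\<lambda>n x. z powi n *\<^sub>C L n x) \<phi>"
  by (intro balanced_isometry_groups.intro R.rotate L.rotate assms zero_product_form_axioms
      balanced_isometry_groups_axioms.intro)
    (simp add: scaleC_mult_left scaleC_mult_right balanced)

lemma balanced_cosine: "R.cosine a * b = a * L.cosine b"
  by (simp add: R.cosine_def L.cosine_def balanced algebra_simps)

lemma balanced_abs_cosine: "R.abs_cosine a * b = a * L.abs_cosine b"
proof (rule has_sum_unique)
  show "((\<lambda>j. (abscos_coeff j *\<^sub>R R (2 * j) a) * b) has_sum (R.abs_cosine a * b)) UNIV"
    by (rule has_sum_bounded_linear[OF bounded_linear_mult_left R.abs_cosine_has_sum])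
  show "((\<lambda>j. (abscos_coeff j *\<^sub>R R (2 * j) a) * b) has_sum (a * L.abs_cosine b)) UNIV"
    using has_sum_bounded_linear[OF bounded_linear_mult_right L.abs_cosine_has_sum, of a b]
    by (simp add: balanced)
qed

text \<open>
  With \<open>u\<close>, \<open>u'\<close> denoting \<open>\<bar>cos\<bar>\<close> and \<open>v\<close>, \<open>v'\<close> denoting \<open>cos\<close> in the two arguments, the map \<open>\<phi>\<close>
  kills the zero products \<open>(u + v) (u' - v')\<close> and \<open>(u - v) (u' + v')\<close>; the difference of the two
  relations is twice the claim.
\<close>

lemma form_cosine_abs_cosine: "\<phi> (R.cosine a) (L.abs_cosine b) = \<phi> (R.abs_cosine a) (L.cosine b)"
proof -
  have "(R.abs_cosine a + R.cosine a) * (L.abs_cosine b - L.cosine b) =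
      a * (L.cosine (L.abs_cosine b - L.cosine b) + L.abs_cosine (L.abs_cosine b - L.cosine b))"
    by (simp only: distrib_right distrib_left balanced_cosine balanced_abs_cosine add.commute)
  then have 1: "\<phi> (R.abs_cosine a + R.cosine a) (L.abs_cosine b - L.cosine b) = 0"
    by (intro zero_product) (simp add: L.abs_cosine_factor)
  have "(R.abs_cosine a - R.cosine a) * (L.abs_cosine b + L.cosine b) =
      a * (L.abs_cosine (L.abs_cosine b + L.cosine b) - L.cosine (L.abs_cosine b + L.cosine b))"
    by (simp only: left_diff_distrib right_diff_distrib balanced_cosine balanced_abs_cosine)
  then have 2: "\<phi> (R.abs_cosine a - R.cosine a) (L.abs_cosine b + L.cosine b) = 0"
    by (intro zero_product) (simp add: L.abs_cosine_factor')
  have "2 *\<^sub>R (\<phi> (R.cosine a) (L.abs_cosine b) - \<phi> (R.abs_cosine a) (L.cosine b)) =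
      \<phi> (R.abs_cosine a + R.cosine a) (L.abs_cosine b - L.cosine b) -
      \<phi> (R.abs_cosine a - R.cosine a) (L.abs_cosine b + L.cosine b)"
    by (simp add: form_linear_simps scaleR_2)
  then show ?thesis by (simp add: 1 2)
qed

text \<open>
  The part of the relation \<open>form_cosine_abs_cosine\<close> that pairs the summand \<open>U ^ s\<close> of the cosine,
  \<open>s = 1\<close> or \<open>s = - 1\<close>, with the \<open>j\<close>-th term of the series for \<open>\<bar>cos\<bar>\<close>. Replacing \<open>U\<close> by \<open>z U\<close>
  multiplies it by \<open>z ^ (2 * j + s)\<close>.
\<close>

definition cross_term :: "'a \<Rightarrow> 'a \<Rightarrow> int \<Rightarrow> int \<Rightarrow> 'x"
  where "cross_term a b s j = abscos_coeff j *\<^sub>R (\<phi> (R s a) (L (2 * j) b) - \<phi> (R (2 * j) a) (L s b))"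

lemma form_cosine_expansion:
  "((\<lambda>j. cross_term a b 1 j + cross_term a b (- 1) j) has_sum 0) UNIV"
proof -
  have "((\<lambda>j. \<phi> (R.cosine a) (abscos_coeff j *\<^sub>R L (2 * j) b) - \<phi> (abscos_coeff j *\<^sub>R R (2 * j) a) (L.cosine b))
      has_sum (\<phi> (R.cosine a) (L.abs_cosine b) + - \<phi> (R.abs_cosine a) (L.cosine b))) UNIV"
    unfolding diff_conv_add_uminus
  proof (intro has_sum_add has_sum_bounded_linear[OF bounded_linear_minus[OF bounded_linear_ident]])
    show "((\<lambda>j. \<phi> (R.cosine a) (abscos_coeff j *\<^sub>R L (2 * j) b)) has_sum \<phi> (R.cosine a) (L.abs_cosine b)) UNIV"
      by (rule has_sum_bounded_linear[OF bounded_bilinear.bounded_linear_right[OF bilinear] L.abs_cosine_has_sum])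
    show "((\<lambda>j. \<phi> (abscos_coeff j *\<^sub>R R (2 * j) a) (L.cosine b)) has_sum \<phi> (R.abs_cosine a) (L.cosine b)) UNIV"
      by (rule has_sum_bounded_linear[OF bounded_bilinear.bounded_linear_left[OF bilinear] R.abs_cosine_has_sum])
  qed
  then have "((\<lambda>j. (4 / pi) *\<^sub>R (\<phi> (R.cosine a) (abscos_coeff j *\<^sub>R L (2 * j) b) -
      \<phi> (abscos_coeff j *\<^sub>R R (2 * j) a) (L.cosine b))) has_sum (4 / pi) *\<^sub>R 0) UNIV"
    by (intro has_sum_bounded_linear[OF bounded_linear_scaleR_right]) (simp add: form_cosine_abs_cosine)
  moreover have "(4 / pi) *\<^sub>R (\<phi> (R.cosine a) (abscos_coeff j *\<^sub>R L (2 * j) b) -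
      \<phi> (abscos_coeff j *\<^sub>R R (2 * j) a) (L.cosine b)) = cross_term a b 1 j + cross_term a b (- 1) j" for j
    by (simp add: cross_term_def R.cosine_def L.cosine_def form_linear_simps algebra_simps)
  ultimately show ?thesis by simp
qed

lemma cross_term_summable: "(\<lambda>j. norm (cross_term a b s j)) summable_on UNIV"
proof -
  obtain K where K: "\<And>x y. norm (\<phi> x y) \<le> norm x * norm y * K"
    using bounded_bilinear.bounded[OF bilinear] by auto
  have "norm (cross_term a b s j) \<le> \<bar>abscos_coeff j\<bar> * (2 * (norm a * norm b * K))" for j
  proof -
    have "norm (\<phi> (R s a) (L (2 * j) b) - \<phi> (R (2 * j) a) (L s b)) \<le> 2 * (norm a * norm b * K)"
      using norm_triangle_ineq4[of "\<phi> (R s a) (L (2 * j) b)" "\<phi> (R (2 * j) a) (L s b)"]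
        K[of "R s a" "L (2 * j) b"] K[of "R (2 * j) a" "L s b"]
      by (simp add: R.W_norm L.W_norm)
    then show ?thesis
      unfolding cross_term_def norm_scaleR by (intro mult_left_mono) auto
  qed
  then show ?thesis
    by (rule Infinite_Sum.abs_summable_on_comparison_test'[OF
          summable_on_cmult_left[OF abscos_coeff_abs_summable]])
qed

end

text \<open>
  The coefficient of \<open>z\<close> in the rotated relation. Writing \<open>x\<close> and \<open>y\<close> for the actions of \<open>U\<close> on
  the two arguments it reads \<open>3 x + y\<^sup>2 / x = 3 y + x\<^sup>2 / y\<close>, that is \<open>(x - y)\<^sup>3 = 0\<close> after
  multiplication by \<open>x y\<close>. The ratio \<open>3\<close> of the coefficients of \<open>\<bar>cos\<bar>\<close> at \<open>0\<close> and \<open>1\<close> is what makes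
  it a perfect cube.
\<close>

lemma (in balanced_isometry_groups) form_cubic_relation:
  "3 *\<^sub>R \<phi> (R 1 a) (L 0 b) + \<phi> (R (- 1) a) (L 2 b) = 3 *\<^sub>R \<phi> (R 0 a) (L 1 b) + \<phi> (R 2 a) (L (- 1) b)"
proof -
  define D where "D j = cross_term a b 1 j + cross_term a b (- 1) (j + 1)" for j
  have lowsum: "(\<lambda>j. norm (cross_term a b (- 1) (j + 1))) summable_on UNIV"
    using has_sum_int_shift[of "\<lambda>j. norm (cross_term a b (- 1) j)" 1] cross_term_summable[of a b "- 1"]
    by (simp only: summable_on_def)
  have "(\<lambda>j. norm (D j)) summable_on UNIV"
    by (rule Infinite_Sum.abs_summable_on_comparison_test'[OF
          summable_on_add[OF cross_term_summable[of a b 1] lowsum]])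
      (simp add: D_def norm_triangle_ineq)
  moreover have "((\<lambda>j. z powi j *\<^sub>C D j) has_sum 0) UNIV" if z: "cmod z = 1" for z
  proof -
    \<comment> \<open>Rotating by \<open>w\<close> produces odd powers of \<open>w\<close> only; after division by \<open>w\<close> the series is one in \<open>w\<^sup>2 = z\<close>.\<close>
    define w where "w = csqrt z"
    have w: "cmod w = 1" "w\<^sup>2 = z" "w \<noteq> 0"
      using z by (auto simp: w_def)
    interpret rot: balanced_isometry_groups "\<lambda>n x. w powi n *\<^sub>C R n x" "\<lambda>n x. w powi n *\<^sub>C L n x" \<phi>
      by (rule rotate_balanced[OF w(1)])
    have rl: "rot.cross_term a b s j = w powi (2 * j + s) *\<^sub>C cross_term a b s j" for s j
    proof -
      have sc: "r *\<^sub>R (c *\<^sub>C x) = c *\<^sub>C (r *\<^sub>R x)" for r c and x :: 'x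
        by (simp add: scaleR_scaleC scaleC_scaleC mult.commute)
      show ?thesis
        by (simp add: rot.cross_term_def cross_term_def scaleC_left scaleC_right scaleC_scaleC sc
            complex_vector.scale_right_diff_distrib[symmetric] power_int_add w mult.commute)
    qed
    have s: "(\<lambda>j. norm (rot.cross_term a b s j)) summable_on UNIV" for s
      by (rule rot.cross_term_summable)
    obtain p q where p: "((\<lambda>j. rot.cross_term a b 1 j) has_sum p) UNIV"
      and q: "((\<lambda>j. rot.cross_term a b (- 1) j) has_sum q) UNIV"
      using abs_summable_summable[OF s] by (meson summable_on_def)
    from has_sum_add[OF p q] have "p + q = 0"
      using rot.form_cosine_expansion[of a b] has_sum_unique by blast
    moreover have "((\<lambda>j. rot.cross_term a b (- 1) (j + 1)) has_sum q) UNIV"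
      using q by (rule has_sum_int_shift[THEN iffD2])
    ultimately have "((\<lambda>j. rot.cross_term a b 1 j + rot.cross_term a b (- 1) (j + 1)) has_sum 0) UNIV"
      using has_sum_add[OF p, of "\<lambda>j. rot.cross_term a b (- 1) (j + 1)" q] by simp
    then have "((\<lambda>j. inverse w *\<^sub>C (rot.cross_term a b 1 j + rot.cross_term a b (- 1) (j + 1))) has_sum inverse w *\<^sub>C 0) UNIV"
      by (rule has_sum_bounded_linear[OF bounded_linear_scaleC])
    moreover have "inverse w *\<^sub>C (rot.cross_term a b 1 j + rot.cross_term a b (- 1) (j + 1)) = z powi j *\<^sub>C D j" for j
    proof -
      have e: "w powi (2 * j + 1) = w * z powi j" "w powi (2 * (j + 1) + - 1) = w * z powi j"
        by (simp_all add: power_int_add w power_int_mult flip: w(2))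
      show ?thesis
        unfolding rl e D_def
        by (simp add: scaleC_add_right[symmetric] scaleC_scaleC mult.assoc[symmetric] w)
    qed
    ultimately show ?thesis by simp
  qed
  ultimately have "D 0 = 0"
    by (rule fourier_coefficient_zero)
  then have "3 *\<^sub>R D 0 = 0" by simp
  then show ?thesis
    by (simp add: D_def cross_term_def abscos_coeff_0 abscos_coeff_1 algebra_simps)
qed

lemma bounded_affine_sequence_const:
  fixes g :: "nat \<Rightarrow> 'x::real_normed_vector"
  assumes "\<And>n. g (Suc n) - g n = d" "\<And>n. norm (g n) \<le> B"
  shows "d = 0"
proof -
  have g: "g n = g 0 + real n *\<^sub>R d" for n
  proof (induction n)
    case (Suc n)
    have "g (Suc n) = g n + d" using assms(1)[of n] by (simp add: algebra_simps)
    then show ?case by (simp add: Suc algebra_simps)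
  qed simp
  have bd: "real n * norm d \<le> 2 * B" for n
  proof -
    have "real n *\<^sub>R d = g n - g 0" by (simp add: g[of n])
    then have "real n * norm d = norm (g n - g 0)"
      by (metis abs_of_nat norm_scaleR)
    also have "\<dots> \<le> 2 * B"
      using norm_triangle_ineq4[of "g n" "g 0"] assms(2)[of n] assms(2)[of 0] by simp
    finally show ?thesis .
  qed
  show "d = 0"
  proof (rule ccontr)
    assume "d \<noteq> 0"
    then obtain n where "2 * B < real n * norm d"
      using reals_Archimedean3[of "norm d"] by auto
    with bd[of n] show False by simp
  qed
qed

text \<open>
  The sequence is a quadratic polynomial in \<open>n\<close>; being bounded, it is constant.
\<close>

lemma bounded_third_difference_zero:
  fixes g :: "nat \<Rightarrow> 'x::real_normed_vector"
  assumes third: "\<And>n. g (n + 3) + 3 *\<^sub>R g (n + 1) = 3 *\<^sub>R g (n + 2) + g n"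
    and bounded: "\<And>n. norm (g n) \<le> B"
  shows "g 1 = g 0"
proof -
  define d where "d n = g (Suc n) - g n" for n
  define e where "e n = d (Suc n) - d n" for n
  have d: "norm (d n) \<le> 2 * B" for n
    using norm_triangle_ineq4[of "g (Suc n)" "g n"] bounded[of n] bounded[of "Suc n"]
    by (simp add: d_def)
  have triple: "3 *\<^sub>R v = v + v + v" for v :: 'x
    using scaleR_left_distrib[of 2 1 v] by (simp add: scaleR_2)
  have "e (Suc n) = e n" for n
    using third[of n] unfolding triple by (simp add: e_def d_def numeral_eq_Suc algebra_simps)
  then have "e n = e 0" for n
    by (induction n) auto
  then have "e 0 = 0"
    using bounded_affine_sequence_const[of d "e 0", OF _ d] by (simp add: e_def)
  with \<open>\<And>n. e n = e 0\<close> have "d (Suc n) = d n" for n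
    using e_def[of n] by simp
  then have "d n = d 0" for n
    by (induction n) auto
  then have "d 0 = 0"
    using bounded_affine_sequence_const[of g "d 0", OF _ bounded] by (simp add: d_def)
  then show ?thesis by (simp add: d_def)
qed

proposition (in balanced_isometry_groups) form_balanced: "\<phi> (R 1 a) b = \<phi> a (L 1 b)"
proof -
  \<comment> \<open>The exponents add up to \<open>1\<close>, which makes \<open>g 1\<close> and \<open>g 0\<close> the two sides of the claim.\<close>
  define g where "g n = \<phi> (R (int n) a) (L (1 - int n) b)" for n
  obtain K where K: "\<And>x y. norm (\<phi> x y) \<le> norm x * norm y * K"
    using bounded_bilinear.bounded[OF bilinear] by auto
  have "norm (g n) \<le> norm a * norm b * K" for n
    using K[of "R (int n) a" "L (1 - int n) b"] by (simp add: g_def R.W_norm L.W_norm)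
  moreover have "g (n + 3) + 3 *\<^sub>R g (n + 1) = 3 *\<^sub>R g (n + 2) + g n" for n
    using form_cubic_relation[of "R (int n + 1) a" "L (- 1 - int n) b"]
    by (simp add: g_def R.W_add[symmetric] L.W_add[symmetric] add.commute)
  ultimately have "g 1 = g 0"
    by (intro bounded_third_difference_zero)
  then show ?thesis
    by (simp add: g_def R.W_0 L.W_0)
qed

section \<open>Unitaries and zero products in C*-algebras\<close>

definition int_power :: "('a \<Rightarrow> 'a) \<Rightarrow> ('a \<Rightarrow> 'a) \<Rightarrow> int \<Rightarrow> 'a \<Rightarrow> 'a"
  where "int_power f g n = (if 0 \<le> n then f ^^ nat n else g ^^ nat (- n))"

lemma int_power_succ:
  assumes "\<And>x. f (g x) = x"
  shows "int_power f g (n + 1) x = f (int_power f g n x)"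
proof (cases "0 \<le> n")
  case True
  then have "nat (n + 1) = Suc (nat n)" by simp
  with True show ?thesis by (simp add: int_power_def)
next
  case False
  define k where "k = nat (- n - 1)"
  have k: "nat (- n) = Suc k" "n + 1 \<ge> 0 \<Longrightarrow> k = 0 \<and> n + 1 = 0" "nat (- (n + 1)) = k"
    using False by (auto simp: k_def)
  show ?thesis
  proof (cases "n + 1 \<ge> 0")
    case True
    with k False show ?thesis by (simp add: int_power_def assms)
  next
    case F2: False
    show ?thesis using False F2 k(1,3) by (simp only: int_power_def if_False funpow.simps o_def assms)
  qed
qed

lemma isometry_group_int_power:
  fixes f g :: "'a::complex_banach \<Rightarrow> 'a"
  assumes fg: "\<And>x. f (g x) = x" and gf: "\<And>x. g (f x) = x"
    and f: "\<And>x y. f (x + y) = f x + f y" "\<And>c x. f (c *\<^sub>C x) = c *\<^sub>C f x" "\<And>x. norm (f x) = norm x"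
  shows "isometry_group (int_power f g)"
proof
  have g: "g (x + y) = g x + g y" "g (c *\<^sub>C x) = c *\<^sub>C g x" "norm (g x) = norm x" for x y c
    by (metis fg gf f(1)) (metis fg gf f(2), metis fg f(3))
  let ?W = "int_power f g"
  have pred: "?W (n - 1) x = g (?W n x)" for n x
    using int_power_succ[of f g "n - 1" x, OF fg] by (simp add: gf)
  show W0: "?W 0 x = x" for x
    by (simp add: int_power_def)
  show "?W (m + n) x = ?W m (?W n x)" for m n x
  proof (induction m rule: int_induct[of _ 0])
    case base then show ?case by (simp add: W0)
  next
    case (step1 i)
    have "?W (i + 1 + n) x = ?W ((i + n) + 1) x" by (simp add: algebra_simps)
    then show ?case using step1 by (simp only: int_power_succ[of f g, OF fg])
  next
    case (step2 i)
    have "?W (i - 1 + n) x = ?W ((i + n) - 1) x" by (simp add: algebra_simps)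
    then show ?case using step2 by (simp only: pred)
  qed
  have "(f ^^ k) (x + y) = (f ^^ k) x + (f ^^ k) y" for k x y
    by (induction k) (simp_all add: f)
  moreover have "(g ^^ k) (x + y) = (g ^^ k) x + (g ^^ k) y" for k x y
    by (induction k) (simp_all add: g)
  ultimately show "?W n (x + y) = ?W n x + ?W n y" for n x y
    by (simp add: int_power_def)
  have "(f ^^ k) (c *\<^sub>C x) = c *\<^sub>C (f ^^ k) x" "(g ^^ k) (c *\<^sub>C x) = c *\<^sub>C (g ^^ k) x"
    "norm ((f ^^ k) x) = norm x" "norm ((g ^^ k) x) = norm x" for k c x
    by (induction k) (simp_all add: f g)
  then show "?W n (c *\<^sub>C x) = c *\<^sub>C ?W n x" "norm (?W n x) = norm x" for n c x
    by (simp_all add: int_power_def)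
qed

lemma norm_star: "norm (star a) = norm (a :: 'a::cstar_algebra)"
proof -
  have le: "norm b \<le> norm (star b)" for b :: 'a
  proof (cases "b = 0")
    case False
    have "norm b * norm b \<le> norm (star b) * norm b"
      using cstar_identity[of b] norm_mult_ineq[of "star b" b] by (simp add: power2_eq_square)
    then show ?thesis using False by simp
  qed simp
  show ?thesis
    using le[of a] le[of "star a"] by (simp add: star_star)
qed

lemma norm_star_mult_self: "(norm a)\<^sup>2 = norm (star a * (a :: 'a::cstar_algebra))"
  by (simp add: cstar_identity)

lemma bounded_linear_star: "bounded_linear (star :: 'a::cstar_algebra \<Rightarrow> 'a)"
  by (rule bounded_linear_intro[where K = 1]) (simp_all add: star_add scaleR_scaleC star_scaleC norm_star)

lemmas star_linear_simps = linear_simps[OF bounded_linear_star]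

lemma selfadjoint_decomposition:
  fixes a :: "'a::cstar_algebra"
  obtains h k where "star h = h" "star k = k" "a = h + \<i> *\<^sub>C k"
proof
  let ?h = "(1/2) *\<^sub>C (a + star a)" and ?k = "(- \<i> / 2) *\<^sub>C (a - star a)"
  show "star ?h = ?h"
    by (simp add: star_scaleC star_add star_star add.commute)
  show "star ?k = ?k"
    by (simp add: star_scaleC star_linear_simps star_star complex_vector.scale_right_diff_distrib)
  have "(1/2) *\<^sub>C (a + a) = a"
    by (simp add: scaleR_scaleC scaleC_scaleC scaleC_one flip: scaleR_2)
  then show "a = ?h + \<i> *\<^sub>C ?k"
    by (simp add: scaleC_scaleC flip: scaleC_add_right)
qed

text \<open>
  The condition says that \<open>1 + w\<close> is a unitary of the unitization; a formulation inside the algebra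
  avoids constructing the latter.
\<close>

definition quasi_unitary :: "'a::cstar_algebra \<Rightarrow> bool"
  where "quasi_unitary w \<longleftrightarrow> w + star w + w * star w = 0 \<and> w + star w + star w * w = 0"

lemma quasi_unitary_star: "quasi_unitary w \<Longrightarrow> quasi_unitary (star w)"
  by (simp add: quasi_unitary_def star_star add.commute)

lemma quasi_unitary_norm_left:
  assumes "quasi_unitary w"
  shows "norm (x + w * x) = norm x"
proof -
  have "star (x + w * x) * (x + w * x) = star x * x + star x * (w + star w + star w * w) * x"
    by (simp add: star_add star_mult algebra_simps)
  also have "\<dots> = star x * x"
    using assms by (simp add: quasi_unitary_def)
  finally have "(norm (x + w * x))\<^sup>2 = (norm x)\<^sup>2"
    by (simp only: norm_star_mult_self)
  then show ?thesis by simp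
qed

lemma quasi_unitary_norm_right:
  assumes "quasi_unitary w"
  shows "norm (x + x * w) = norm x"
proof -
  have "star (x + x * w) = star x + star w * star x"
    by (simp add: star_add star_mult)
  then show ?thesis
    using quasi_unitary_norm_left[OF quasi_unitary_star[OF assms], of "star x"]
      norm_star[of "x + x * w"] by (simp add: norm_star)
qed

text \<open>
  In the unitization \<open>1 + s\<close> is the square root of \<open>1 - h\<^sup>2\<close>, so that \<open>(1 + s) + \<i> h\<close> is unitary. The
  element \<open>s\<close> is the fixed point of the contraction \<open>s \<mapsto> - (h\<^sup>2 + s\<^sup>2) / 2\<close> on the ball of radius
  \<open>1/2\<close> of the selfadjoint commutant of \<open>h\<close>.
\<close>

lemma quasi_unitary_of_selfadjoint:
  fixes h :: "'a::cstar_algebra"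
  assumes h: "star h = h" "norm h \<le> 1/2"
  obtains s where "quasi_unitary (s + \<i> *\<^sub>C h)" "star s = s" "s * s + 2 *\<^sub>R s + h * h = 0"
proof -
  define S where "S = {s :: 'a. norm s \<le> 1/2 \<and> star s = s \<and> s * h = h * s}"
  define f where "f s = (- 1/2) *\<^sub>R (h * h + s * s)" for s
  have cont: "continuous_on UNIV (star :: 'a \<Rightarrow> 'a)"
    by (rule bounded_linear.continuous_on[OF bounded_linear_star continuous_on_id])
  have "closed S"
    unfolding S_def by (intro closed_Collect_conj closed_Collect_le closed_Collect_eq continuous_intros cont)
  then have comp: "complete S" by (simp add: complete_eq_closed)
  have mult_le: "norm (x * y) \<le> 1/4" if "norm x \<le> 1/2" "norm y \<le> 1/2" for x y :: 'a
  proof -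
    have "norm (x * y) \<le> norm x * norm y" by (rule norm_mult_ineq)
    also have "\<dots> \<le> 1/2 * (1/2)" using that by (intro mult_mono) auto
    finally show ?thesis by simp
  qed
  have maps: "f ` S \<subseteq> S"
  proof (rule image_subsetI)
    fix s assume s: "s \<in> S"
    then have n: "norm s \<le> 1/2" and ss: "star s = s" and c: "s * h = h * s" by (auto simp: S_def)
    have "norm (h * h + s * s) \<le> 1/2"
      using norm_triangle_ineq[of "h * h" "s * s"] mult_le[OF h(2) h(2)] mult_le[OF n n] by simp
    then have "norm (f s) \<le> 1/2"
      unfolding f_def norm_scaleR by simp
    moreover have "s * s * h = h * (s * s)" by (metis c mult.assoc)
    then have "f s * h = h * f s"
      by (simp add: f_def algebra_simps)
    moreover have "star (f s) = f s"
      by (simp add: f_def star_linear_simps star_mult h ss)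
    ultimately show "f s \<in> S"
      by (simp add: S_def)
  qed
  have lip: "dist (f s) (f t) \<le> 1/2 * dist s t" if "s \<in> S" "t \<in> S" for s t
  proof -
    have n: "norm s \<le> 1/2" "norm t \<le> 1/2" using that by (auto simp: S_def)
    have "s * s - t * t = s * (s - t) + (s - t) * t"
      by (simp add: algebra_simps)
    then have "norm (s * s - t * t) \<le> norm (s * (s - t)) + norm ((s - t) * t)"
      by (metis norm_triangle_ineq)
    also have "\<dots> \<le> 1/2 * norm (s - t) + norm (s - t) * (1/2)"
      by (intro add_mono order_trans[OF norm_mult_ineq] mult_mono n) auto
    finally have "norm (s * s - t * t) \<le> norm (s - t)" by simp
    moreover have "f s - f t = (- 1/2) *\<^sub>R (s * s - t * t)"
      by (simp add: f_def algebra_simps)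
    ultimately show ?thesis by (simp add: dist_norm)
  qed
  have "0 \<in> S" by (simp add: S_def star_linear_simps)
  then obtain s where s: "s \<in> S" "f s = s"
    using Banach_fix[OF comp _ _ _ maps lip] by auto
  have ss: "star s = s" and c: "s * h = h * s" using s by (auto simp: S_def)
  have "2 *\<^sub>R s = 2 *\<^sub>R f s" using s by simp
  then have eq: "s * s + 2 *\<^sub>R s + h * h = 0"
    by (simp add: f_def algebra_simps)
  have sw: "star (s + \<i> *\<^sub>C h) = s - \<i> *\<^sub>C h"
    by (simp add: star_add star_scaleC h ss complex_vector.scale_minus_left)
  have hh: "(\<i> *\<^sub>C h) * (\<i> *\<^sub>C h) = - (h * h)"
    by (simp add: scaleC_mult_left scaleC_mult_right scaleC_scaleC complex_vector.scale_minus_left scaleC_one)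
  have sh: "s * (\<i> *\<^sub>C h) = (\<i> *\<^sub>C h) * s"
    by (simp add: scaleC_mult_left scaleC_mult_right c)
  have "quasi_unitary (s + \<i> *\<^sub>C h)"
    using eq unfolding quasi_unitary_def sw
    by (simp add: distrib_left distrib_right left_diff_distrib right_diff_distrib hh sh scaleR_2 add_ac)
  then show thesis using that ss eq by blast
qed

lemma quasi_unitary_inverse:
  assumes "quasi_unitary w"
  shows "(x + star w * x) + w * (x + star w * x) = x"
    and "(x + x * star w) + (x + x * star w) * w = x"
proof -
  have "(x + star w * x) + w * (x + star w * x) = x + (w + star w + w * star w) * x"
    by (simp add: algebra_simps)
  then show "(x + star w * x) + w * (x + star w * x) = x"
    using assms by (simp add: quasi_unitary_def)
  have "(x + x * star w) + (x + x * star w) * w = x + x * (w + star w + star w * w)"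
    by (simp add: algebra_simps)
  then show "(x + x * star w) + (x + x * star w) * w = x"
    using assms by (simp add: quasi_unitary_def)
qed


lemma zero_product_form_quasi_unitary:
  fixes w :: "'a::cstar_algebra" and \<phi> :: "'a \<Rightarrow> 'a \<Rightarrow> 'x::complex_banach"
  assumes "zero_product_form \<phi>" and w: "quasi_unitary w"
  shows "\<phi> (a * w) b = \<phi> a (w * b)"
proof -
  interpret zero_product_form \<phi> by fact
  let ?l = "\<lambda>v x. x + v * x" and ?r = "\<lambda>v x. x + x * v"
  let ?L = "int_power (?l w) (?l (star w))" and ?R = "int_power (?r w) (?r (star w))"
  note w' = quasi_unitary_star[OF w]
  note inv = quasi_unitary_inverse[OF w] quasi_unitary_inverse[OF w', unfolded star_star]
  have L: "isometry_group ?L"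
    by (rule isometry_group_int_power)
      (simp_all only: inv quasi_unitary_norm_left[OF w], simp_all add: scaleC_mult_right scaleC_add_right algebra_simps)
  have R: "isometry_group ?R"
    by (rule isometry_group_int_power)
      (simp_all only: inv quasi_unitary_norm_right[OF w], simp_all add: scaleC_mult_left scaleC_add_right algebra_simps)
  interpret L: isometry_group ?L by (rule L)
  interpret R: isometry_group ?R by (rule R)
  have one: "?L 1 x = x + w * x" "?R 1 x = x + x * w" "?L (- 1) x = x + star w * x" "?R (- 1) x = x + x * star w" for x
    by (simp_all add: int_power_def)
  have bal: "?R n x * y = x * ?L n y" for n x y
  proof (induction n arbitrary: x y rule: int_induct[of _ 0])
    case base then show ?case by (simp add: L.W_0 R.W_0)
  next
    case (step1 i)
    have "?R (1 + i) x * y = ?R i x * ?L 1 y"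
      unfolding R.W_add one by (simp add: algebra_simps)
    also have "\<dots> = x * ?L (i + 1) y" unfolding L.W_add by (rule step1)
    finally show ?case by (simp only: add.commute)
  next
    case (step2 i)
    have "?R (- 1 + i) x * y = ?R i x * ?L (- 1) y"
      unfolding R.W_add one by (simp add: algebra_simps)
    also have "\<dots> = x * ?L (i + - 1) y" unfolding L.W_add by (rule step2)
    finally show ?case by (simp add: add.commute)
  qed
  interpret balanced_isometry_groups ?R ?L \<phi>
    by unfold_locales (rule bal)
  have "\<phi> (a + a * w) b = \<phi> a (b + w * b)"
    using form_balanced[of a b] by (simp only: one)
  then show ?thesis by (simp add: form_linear_simps)
qed

proposition cstar_zero_product_determined:
  fixes \<phi> :: "'a::cstar_algebra \<Rightarrow> 'a \<Rightarrow> 'x::complex_banach"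
  assumes "zero_product_form \<phi>"
  shows "\<phi> (a * x) b = \<phi> a (x * b)"
proof -
  interpret zero_product_form \<phi> by fact
  have small: "\<phi> (a * h) b = \<phi> a (h * b)" if h: "star h = h" "norm h \<le> 1/2" for h
  proof -
    obtain s where s: "quasi_unitary (s + \<i> *\<^sub>C h)" "star s = s"
      using quasi_unitary_of_selfadjoint[OF h] by metis
    have "star (s + \<i> *\<^sub>C h) = s - \<i> *\<^sub>C h"
      by (simp add: star_add star_scaleC h s complex_vector.scale_minus_left)
    then have "quasi_unitary (s - \<i> *\<^sub>C h)"
      using quasi_unitary_star[OF s(1)] by simp
    note e = zero_product_form_quasi_unitary[OF assms s(1), of a b]
      zero_product_form_quasi_unitary[OF assms this, of a b]
    have "\<phi> a (s * b) + \<i> *\<^sub>C \<phi> a (h * b) - (\<phi> a (s * b) - \<i> *\<^sub>C \<phi> a (h * b)) =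
        \<phi> (a * s) b + \<i> *\<^sub>C \<phi> (a * h) b - (\<phi> (a * s) b - \<i> *\<^sub>C \<phi> (a * h) b)"
      using e by (simp add: distrib_left distrib_right left_diff_distrib right_diff_distrib
          form_linear_simps scaleC_mult_left scaleC_mult_right scaleC_left scaleC_right)
    then have "2 *\<^sub>R (\<i> *\<^sub>C \<phi> a (h * b)) = 2 *\<^sub>R (\<i> *\<^sub>C \<phi> (a * h) b)"
      by (simp add: scaleR_2)
    then show ?thesis by simp
  qed
  have sa: "\<phi> (a * h) b = \<phi> a (h * b)" if h: "star h = h" for h
  proof -
    define r where "r = 1 / (2 * (norm h + 1))"
    have r: "r > 0" "r * norm h \<le> 1/2"
      by (simp_all add: r_def field_simps add_pos_nonneg) 
    have "\<phi> (a * (r *\<^sub>R h)) b = \<phi> a ((r *\<^sub>R h) * b)"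
      by (rule small) (use r h in \<open>auto simp: linear_simps[OF bounded_linear_star]\<close>)
    then show ?thesis using r by (simp add: form_linear_simps)
  qed
  obtain h k where "star h = h" "star k = k" "x = h + \<i> *\<^sub>C k"
    by (rule selfadjoint_decomposition)
  then show ?thesis
    by (simp add: distrib_left distrib_right form_linear_simps scaleC_mult_left scaleC_mult_right
        scaleC_left scaleC_right sa)
qed

section \<open>Approximate identities in C*-algebras\<close>

text \<open>
  The element \<open>1 - e\<close> of the unitization acts as a contraction on both sides.
\<close>

definition co_contraction :: "'a::cstar_algebra \<Rightarrow> bool"
  where "co_contraction e \<longleftrightarrow> (\<forall>x. norm (x - e * x) \<le> norm x \<and> norm (x - x * e) \<le> norm x)"

lemma co_contraction_0: "co_contraction 0"
  by (simp add: co_contraction_def)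

text \<open>
  Contractions are closed under products: \<open>1 - (e + f - e * f) = (1 - e) * (1 - f)\<close>.
\<close>

lemma co_contraction_circle:
  assumes "co_contraction e" "co_contraction f"
  shows "co_contraction (e + f - e * f)"
  unfolding co_contraction_def
proof (intro allI conjI)
  fix x
  have "x - (e + f - e * f) * x = (x - f * x) - e * (x - f * x)"
    by (simp add: algebra_simps)
  then show "norm (x - (e + f - e * f) * x) \<le> norm x"
    using assms order_trans unfolding co_contraction_def by metis
  have "x - x * (e + f - e * f) = (x - x * e) - (x - x * e) * f"
    by (simp add: algebra_simps)
  then show "norm (x - x * (e + f - e * f)) \<le> norm x"
    using assms order_trans unfolding co_contraction_def by metis
qed

lemma co_contraction_star:
  assumes "co_contraction e"
  shows "co_contraction (star e)"
  unfolding co_contraction_def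
proof (intro allI conjI)
  fix x
  have "star (x - star e * x) = star x - star x * e" "star (x - x * star e) = star x - e * star x"
    by (simp_all add: star_linear_simps star_mult star_star)
  then show "norm (x - star e * x) \<le> norm x" "norm (x - x * star e) \<le> norm x"
    using assms norm_star unfolding co_contraction_def by metis+
qed

lemma co_contraction_average:
  fixes p :: "nat \<Rightarrow> 'a::cstar_algebra"
  assumes "\<And>k. k < n \<Longrightarrow> co_contraction (p k)" "n > 0"
  shows "co_contraction ((1 / real n) *\<^sub>R (\<Sum>k<n. p k))"
  unfolding co_contraction_def
proof (intro allI conjI)
  fix x :: 'a
  have avg: "norm ((1 / real n) *\<^sub>R (\<Sum>k<n. x - q k)) \<le> norm x"
    if "\<And>k. k < n \<Longrightarrow> norm (x - q k) \<le> norm x" for q :: "nat \<Rightarrow> 'a"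
  proof -
    have "norm (\<Sum>k<n. x - q k) \<le> (\<Sum>k<n. norm x)"
      using that by (intro sum_norm_le) auto
    then show ?thesis using \<open>n > 0\<close> by (simp add: field_simps)
  qed
  have x: "x = (1 / real n) *\<^sub>R (\<Sum>k<n. x)"
    using \<open>n > 0\<close> by (simp add: sum_constant_scaleR)
  have "x - ((1 / real n) *\<^sub>R (\<Sum>k<n. p k)) * x = (1 / real n) *\<^sub>R (\<Sum>k<n. x - p k * x)"
    by (subst x) (simp add: sum_subtractf sum_distrib_right scaleR_diff_right)
  then show "norm (x - ((1 / real n) *\<^sub>R (\<Sum>k<n. p k)) * x) \<le> norm x"
    using avg[of "\<lambda>k. p k * x"] assms(1) by (simp add: co_contraction_def)
  have "x - x * ((1 / real n) *\<^sub>R (\<Sum>k<n. p k)) = (1 / real n) *\<^sub>R (\<Sum>k<n. x - x * p k)"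
    by (subst x) (simp add: sum_subtractf sum_distrib_left scaleR_diff_right)
  then show "norm (x - x * ((1 / real n) *\<^sub>R (\<Sum>k<n. p k))) \<le> norm x"
    using avg[of "\<lambda>k. x * p k"] assms(1) by (simp add: co_contraction_def)
qed

text \<open>
  The bound is obtained by applying the contraction \<open>1 - e\<close> to \<open>star e\<close>.
\<close>

lemma co_contraction_norm:
  assumes "co_contraction e"
  shows "norm e \<le> 2"
proof -
  have "norm e * norm e = norm (e * star e)"
    using cstar_identity[of "star e"] by (simp add: star_star norm_star power2_eq_square)
  also have "\<dots> = norm (star e - (star e - e * star e))" by simp
  also have "\<dots> \<le> norm (star e) + norm (star e - e * star e)" by (rule norm_triangle_ineq4)
  also have "\<dots> \<le> norm e + norm e"
    using assms[unfolded co_contraction_def, rule_format, of "star e"] by (simp add: norm_star)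
  finally have "norm e * norm e \<le> 2 * norm e" by simp
  then show ?thesis by (cases "norm e = 0") auto
qed

text \<open>
  If \<open>U = sqrt (1 - h\<^sup>2) + \<i> h\<close>, then \<open>1 - h\<^sup>2\<close> is the square of \<open>(U + star U) / 2\<close>, a mean of two
  isometries.
\<close>

lemma co_contraction_square:
  fixes h :: "'a::cstar_algebra"
  assumes h: "star h = h" "norm h \<le> 1/2"
  shows "co_contraction (h * h)"
proof -
  obtain s where s: "quasi_unitary (s + \<i> *\<^sub>C h)" "star s = s" "s * s + 2 *\<^sub>R s + h * h = 0"
    using quasi_unitary_of_selfadjoint[OF h] by metis
  define w where "w = s + \<i> *\<^sub>C h"
  have w: "quasi_unitary w" "quasi_unitary (star w)"
    using s quasi_unitary_star by (auto simp: w_def)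
  have ws: "w + star w = 2 *\<^sub>R s"
    by (simp add: w_def star_add star_scaleC h s complex_vector.scale_minus_left scaleR_2)
  have hh: "h * h = - (2 *\<^sub>R s + s * s)"
    using s(3) by (simp add: add_eq_0_iff algebra_simps)
  have left: "norm (x + s * x) \<le> norm x" for x
  proof -
    have "2 *\<^sub>R (x + s * x) = (x + w * x) + (x + star w * x)"
      using arg_cong[OF ws, of "\<lambda>v. v * x"] by (simp add: distrib_right scaleR_add_right scaleR_2)
    then have "norm (2 *\<^sub>R (x + s * x)) \<le> norm (x + w * x) + norm (x + star w * x)"
      by (metis norm_triangle_ineq)
    then show ?thesis by (simp add: quasi_unitary_norm_left w)
  qed
  have right: "norm (x + x * s) \<le> norm x" for x
  proof -
    have "2 *\<^sub>R (x + x * s) = (x + x * w) + (x + x * star w)"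
      using arg_cong[OF ws, of "\<lambda>v. x * v"] by (simp add: distrib_left scaleR_add_right scaleR_2)
    then have "norm (2 *\<^sub>R (x + x * s)) \<le> norm (x + x * w) + norm (x + x * star w)"
      by (metis norm_triangle_ineq)
    then show ?thesis by (simp add: quasi_unitary_norm_right w)
  qed
  show ?thesis
    unfolding co_contraction_def
  proof (intro allI conjI)
    fix x
    have "x - h * h * x = (x + s * x) + s * (x + s * x)"
      by (simp add: hh algebra_simps scaleR_2)
    then show "norm (x - h * h * x) \<le> norm x"
      using left order_trans by metis
    have "x - x * (h * h) = (x + x * s) + (x + x * s) * s"
      by (simp add: hh algebra_simps scaleR_2)
    then show "norm (x - x * (h * h)) \<le> norm x"
      using right order_trans by metis
  qed
qed

text \<open>
  Take \<open>1 - e\<close> to be the mean of the contractions \<open>(1 - h\<^sup>2) ^ k\<close> for \<open>k < n\<close>. Then \<open>h\<^sup>2 * (1 - e)\<close>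
  telescopes to \<open>(1 - (1 - h\<^sup>2) ^ n) / n\<close>, and the C*-identity bounds the square of the norm of
  \<open>h * (1 - e)\<close> by the norm of that element. The explicit form of \<open>e\<close> shows that it is killed by whatever kills
  \<open>h\<^sup>2\<close> from the left.
\<close>

lemma approximate_unit_selfadjoint_small:
  fixes h :: "'a::cstar_algebra"
  assumes h: "star h = h" "norm h \<le> 1/2" and "\<epsilon> > 0"
  obtains e r y where "co_contraction e" "norm (h - h * e) < \<epsilon>" "e = r *\<^sub>R (h * h) + h * h * y"
proof -
  \<comment> \<open>In the unitization, \<open>p k = 1 - (1 - h\<^sup>2) ^ k\<close>.\<close>
  define p where "p = rec_nat 0 (\<lambda>_ q. h * h + q - h * h * q)"
  have p: "p 0 = 0" "p (Suc k) = h * h + p k - h * h * p k" for k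
    by (simp_all add: p_def)
  have pc: "co_contraction (p k)" for k
  proof (induction k)
    case (Suc k)
    then show ?case
      unfolding p by (rule co_contraction_circle[OF co_contraction_square[OF h]])
  qed (simp add: p co_contraction_0)
  have pf: "\<exists>r y. p k = r *\<^sub>R (h * h) + h * h * y" for k
  proof (induction k)
    case 0
    show ?case by (rule exI[of _ 0], rule exI[of _ 0]) (simp add: p)
  next
    case (Suc k)
    then obtain r y where "p k = r *\<^sub>R (h * h) + h * h * y" by blast
    then have "p (Suc k) = (1 + r) *\<^sub>R (h * h) + h * h * (y - p k)"
      unfolding p by (simp add: algebra_simps)
    then show ?case by blast
  qed
  then obtain r y where ry: "\<And>k. p k = r k *\<^sub>R (h * h) + h * h * y k" by metis
  obtain n :: nat where n: "2 / \<epsilon>\<^sup>2 < real n" using reals_Archimedean2 by blast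
  then have "n > 0" using \<open>\<epsilon> > 0\<close> by (metis divide_nonneg_pos gr0I linorder_not_less of_nat_0 zero_le_numeral zero_less_power)
  define e where "e = (1 / real n) *\<^sub>R (\<Sum>k<n. p k)"
  have e: "co_contraction e"
    unfolding e_def by (rule co_contraction_average[OF pc \<open>n > 0\<close>])
  have "(\<Sum>k<m. h * h - h * h * p k) = p m" for m
    by (induction m) (simp_all add: p algebra_simps)
  moreover have "h * h - h * h * e = (1 / real n) *\<^sub>R (\<Sum>k<n. h * h - h * h * p k)"
    using \<open>n > 0\<close> by (simp add: e_def sum_subtractf sum_distrib_left scaleR_diff_right sum_constant_scaleR)
  ultimately have hhe: "h * h - h * h * e = (1 / real n) *\<^sub>R p n" by simp
  have "star (h - h * e) * (h - h * e) = (h * h - h * h * e) - star e * (h * h - h * h * e)"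
    by (simp add: star_linear_simps star_mult h algebra_simps)
  then have "(norm (h - h * e))\<^sup>2 \<le> norm (h * h - h * h * e)"
    using co_contraction_star[OF e] by (simp add: norm_star_mult_self co_contraction_def)
  also have "\<dots> \<le> 2 / real n"
    using co_contraction_norm[OF pc, of n] \<open>n > 0\<close> by (simp add: hhe divide_right_mono)
  also have "\<dots> < \<epsilon>\<^sup>2"
    using n \<open>n > 0\<close> \<open>\<epsilon> > 0\<close> by (simp add: field_simps)
  finally have "norm (h - h * e) < \<epsilon>"
    using \<open>\<epsilon> > 0\<close> by (simp add: power_less_imp_less_base)
  moreover have "e = (\<Sum>k<n. r k / real n) *\<^sub>R (h * h) + h * h * (\<Sum>k<n. (1 / real n) *\<^sub>R y k)"
    unfolding e_def ry
    by (simp add: sum.distrib scaleR_sum_right sum_distrib_left scaleR_add_right scaleR_sum_left)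
  ultimately show thesis using that e by blast
qed

lemma approximate_unit_selfadjoint:
  fixes h :: "'a::cstar_algebra"
  assumes h: "star h = h" and "\<epsilon> > 0"
  obtains e r y where "co_contraction e" "norm (h - h * e) < \<epsilon>" "e = r *\<^sub>R (h * h) + h * h * y"
proof -
  define c where "c = 1 / (2 * (norm h + 1))"
  have c: "c > 0" "c * norm h \<le> 1/2"
    by (simp_all add: c_def field_simps add_pos_nonneg)
  have "star (c *\<^sub>R h) = c *\<^sub>R h" "norm (c *\<^sub>R h) \<le> 1/2" "c * \<epsilon> > 0"
    using c h \<open>\<epsilon> > 0\<close> by (auto simp: star_linear_simps)
  then obtain e r y where e: "co_contraction e" "norm (c *\<^sub>R h - c *\<^sub>R h * e) < c * \<epsilon>"
    "e = r *\<^sub>R (c *\<^sub>R h * (c *\<^sub>R h)) + c *\<^sub>R h * (c *\<^sub>R h) * y"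
    by (rule approximate_unit_selfadjoint_small)
  have "c *\<^sub>R h - c *\<^sub>R h * e = c *\<^sub>R (h - h * e)"
    by (simp add: scaleR_diff_right)
  then have "norm (h - h * e) < \<epsilon>"
    using e(2) c by simp
  moreover have "e = (r * c * c) *\<^sub>R (h * h) + h * h * ((c * c) *\<^sub>R y)"
    by (subst e(3)) (simp add: mult.assoc)
  ultimately show thesis using that e(1) by blast
qed

text \<open>
  The C*-identity reduces the claim to the selfadjoint element \<open>star a * a\<close>.
\<close>

lemma approximate_unit_right_single:
  fixes a :: "'a::cstar_algebra"
  assumes "\<epsilon> > 0"
  obtains e where "co_contraction e" "norm (a - a * e) < \<epsilon>"
proof -
  have "star (star a * a) = star a * a"
    by (simp add: star_mult star_star)
  then obtain e r y where e: "co_contraction e" "norm (star a * a - star a * a * e) < \<epsilon>\<^sup>2"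
    using approximate_unit_selfadjoint[of "star a * a" "\<epsilon>\<^sup>2"] assms by (metis zero_less_power)
  have "star (a - a * e) * (a - a * e) = (star a * a - star a * a * e) - star e * (star a * a - star a * a * e)"
    by (simp add: star_linear_simps star_mult algebra_simps)
  then have "(norm (a - a * e))\<^sup>2 \<le> norm (star a * a - star a * a * e)"
    using co_contraction_star[OF e(1)] by (simp add: norm_star_mult_self co_contraction_def)
  with e(2) have "(norm (a - a * e))\<^sup>2 < \<epsilon>\<^sup>2" by simp
  then have "norm (a - a * e) < \<epsilon>"
    using assms by (simp add: power_less_imp_less_base)
  with that e show thesis by blast
qed

text \<open>
  Finitely many elements are treated one after the other: multiplying \<open>1 - e\<close> on the right by a further
  contraction \<open>1 - f\<close> does not spoil the estimates already achieved.
\<close>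

lemma approximate_unit_right:
  fixes S :: "'a::cstar_algebra set"
  assumes "finite S" "\<epsilon> > 0"
  shows "\<exists>e. co_contraction e \<and> (\<forall>a\<in>S. norm (a - a * e) < \<epsilon>)"
  using assms(1)
proof (induction S)
  case empty
  then show ?case using co_contraction_0 by blast
next
  case (insert a S)
  then obtain e where e: "co_contraction e" "\<And>b. b \<in> S \<Longrightarrow> norm (b - b * e) < \<epsilon>" by blast
  obtain f where f: "co_contraction f" "norm ((a - a * e) - (a - a * e) * f) < \<epsilon>"
    using approximate_unit_right_single[OF assms(2)] by metis
  have eq: "b - b * (e + f - e * f) = (b - b * e) - (b - b * e) * f" for b
    by (simp add: algebra_simps)
  have "norm (b - b * (e + f - e * f)) < \<epsilon>" if "b \<in> insert a S" for b
    using that f e(2)[of b] unfolding eq co_contraction_def by (metis insertE order_le_less_trans)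
  then show ?case using co_contraction_circle[OF e(1) f(1)] by blast
qed

text \<open>
  Apply \<open>approximate_unit_right\<close> to \<open>S\<close> and to the adjoints of \<open>S\<close>, and multiply: the product
  \<open>(1 - e) * (1 - star f)\<close> is small on both sides.
\<close>

lemma approximate_unit:
  fixes S :: "'a::cstar_algebra set"
  assumes "finite S" "\<epsilon> > 0"
  obtains e where "co_contraction e" "\<And>a. a \<in> S \<Longrightarrow> norm (a - a * e) < \<epsilon> \<and> norm (a - e * a) < \<epsilon>"
proof -
  obtain e where e: "co_contraction e" "\<And>a. a \<in> S \<Longrightarrow> norm (a - a * e) < \<epsilon>"
    using approximate_unit_right[OF assms] by blast
  obtain f where f: "co_contraction f" "\<And>a. a \<in> star ` S \<Longrightarrow> norm (a - a * f) < \<epsilon>"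
    using approximate_unit_right[of "star ` S" \<epsilon>] assms by blast
  define g where "g = e + star f - e * star f"
  have sf: "co_contraction (star f)" by (rule co_contraction_star[OF f(1)])
  have "norm (a - a * g) < \<epsilon> \<and> norm (a - g * a) < \<epsilon>" if "a \<in> S" for a
  proof
    have "a - a * g = (a - a * e) - (a - a * e) * star f"
      by (simp add: g_def algebra_simps)
    then show "norm (a - a * g) < \<epsilon>"
      using sf e(2)[OF that] unfolding co_contraction_def by (metis order_le_less_trans)
    have "star (star a - star a * f) = a - star f * a"
      by (simp add: star_linear_simps star_mult star_star)
    then have "norm (a - star f * a) < \<epsilon>"
      using f(2)[of "star a"] that norm_star[of "star a - star a * f"] by simp
    moreover have "a - g * a = (a - star f * a) - e * (a - star f * a)"
      by (simp add: g_def algebra_simps)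
    ultimately show "norm (a - g * a) < \<epsilon>"
      using e(1) unfolding co_contraction_def by (metis order_le_less_trans)
  qed
  then show thesis
    using that co_contraction_circle[OF e(1) sf] by (simp add: g_def)
qed

text \<open>
  The net is indexed by the finite sets \<open>S\<close> of pairs \<open>(a, n)\<close>, a pair recording the element \<open>a\<close> and
  the precision \<open>1 / (n + 1)\<close> demanded for it.
\<close>

proposition cstar_approximate_identity:
  obtains F :: "'a::cstar_algebra filter"
  where "F \<noteq> bot" "eventually (\<lambda>e. norm e \<le> 2) F"
    "\<And>a. ((\<lambda>e. e * a) \<longlongrightarrow> a) F" "\<And>a. ((\<lambda>e. a * e) \<longlongrightarrow> a) F"
proof -
  define good where "good S e \<longleftrightarrow> co_contraction e \<and> (\<forall>(a, n)\<in>S.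
      norm (a - a * e) < 1 / real (Suc n) \<and> norm (a - e * a) < 1 / real (Suc n))"
    for S and e :: 'a
  have "\<exists>e. good S e" if "finite S" for S :: "('a \<times> nat) set"
  proof -
    define m where "m = (\<Sum>p\<in>S. snd p)"
    have m: "1 / real (Suc m) \<le> 1 / real (Suc n)" if "(a, n) \<in> S" for a n
    proof -
      have "n \<le> m"
        unfolding m_def using member_le_sum[of "(a, n)" S snd] \<open>finite S\<close> that by simp
      then show ?thesis by (simp add: frac_le)
    qed
    obtain e where e: "co_contraction e" "\<And>a. a \<in> fst ` S \<Longrightarrow>
        norm (a - a * e) < 1 / real (Suc m) \<and> norm (a - e * a) < 1 / real (Suc m)"
      by (rule approximate_unit[of "fst ` S" "1 / real (Suc m)"]) (use \<open>finite S\<close> in auto)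
    have "norm (a - a * e) < 1 / real (Suc n) \<and> norm (a - e * a) < 1 / real (Suc n)" if "(a, n) \<in> S" for a n
      using e(2)[of a] m[OF that] that by (force simp del: of_nat_Suc)
    with e(1) have "good S e"
      unfolding good_def by blast
    then show ?thesis by (rule exI)
  qed
  then obtain g where G: "\<And>S. finite S \<Longrightarrow> good S (g S)"
    by metis
  have g1: "co_contraction (g S)" if "finite S" for S
    using G[OF that] by (simp add: good_def)
  have g2: "norm (a - a * g S) < 1 / real (Suc n) \<and> norm (a - g S * a) < 1 / real (Suc n)"
    if "finite S" "(a, n) \<in> S" for S a n
  proof -
    have "\<forall>(a, n)\<in>S. norm (a - a * g S) < 1 / real (Suc n) \<and> norm (a - g S * a) < 1 / real (Suc n)"
      using G[OF that(1)] by (simp add: good_def)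
    from bspec[OF this that(2)] show ?thesis by simp
  qed
  let ?N = "finite_subsets_at_top (UNIV :: ('a \<times> nat) set)"
  have ev: "\<forall>\<^sub>F S in ?N. norm (a - a * g S) < 1 / real (Suc n) \<and> norm (a - g S * a) < 1 / real (Suc n)" for a n
    unfolding eventually_finite_subsets_at_top
    by (intro exI[of _ "{(a, n)}"]) (use g2 in auto)
  have lim: "((\<lambda>S. a * g S) \<longlongrightarrow> a) ?N \<and> ((\<lambda>S. g S * a) \<longlongrightarrow> a) ?N" for a
    unfolding tendsto_iff
  proof (intro conjI allI impI)
    fix \<epsilon> :: real
    assume "\<epsilon> > 0"
    then obtain n where n: "1 / real (Suc n) < \<epsilon>"
      using nat_approx_posE by blast
    show "\<forall>\<^sub>F S in ?N. dist (a * g S) a < \<epsilon>"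
      using ev[of a n] by (rule eventually_mono) (use n in \<open>auto simp: dist_norm norm_minus_commute\<close>)
    show "\<forall>\<^sub>F S in ?N. dist (g S * a) a < \<epsilon>"
      using ev[of a n] by (rule eventually_mono) (use n in \<open>auto simp: dist_norm norm_minus_commute\<close>)
  qed
  show thesis
  proof
    show "filtermap g ?N \<noteq> bot"
      by (simp add: filtermap_bot_iff)
    have "\<forall>\<^sub>F S in ?N. finite S"
      by (rule eventually_finite_subsets_at_top_weakI)
    then show "eventually (\<lambda>e. norm e \<le> 2) (filtermap g ?N)"
      unfolding eventually_filtermap by (rule eventually_mono) (use g1 co_contraction_norm in blast)
    show "((\<lambda>e. e * a) \<longlongrightarrow> a) (filtermap g ?N)" "((\<lambda>e. a * e) \<longlongrightarrow> a) (filtermap g ?N)" for a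
      using lim[of a] by (simp_all add: filterlim_filtermap)
  qed
qed

section \<open>Bimodules\<close>

lemma clinear_iff:
  "clinear f \<longleftrightarrow> (\<forall>x y. f (x + y) = f x + f y) \<and> (\<forall>c x. f (c *\<^sub>C x) = c *\<^sub>C f x)"
  by (simp add: Vector_Spaces.linear_iff complex_vector.vector_space_axioms)

context banach_bimodule
begin

lemma bounded_bilinear_lact: "bounded_bilinear lact"
proof
  show "\<exists>K. \<forall>a b. norm (a \<rhd> b) \<le> norm a * norm b * K"
    using bounded_lact by (auto simp: mult_ac)
qed (use clinear_lact_left clinear_lact_right in \<open>auto simp: clinear_iff scaleR_scaleC\<close>)

lemma bounded_bilinear_ract: "bounded_bilinear ract"
proof
  show "\<exists>K. \<forall>a b. norm (a \<lhd> b) \<le> norm a * norm b * K"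
    using bounded_ract by (auto simp: mult_ac)
qed (use clinear_ract_left clinear_ract_right in \<open>auto simp: clinear_iff scaleR_scaleC\<close>)

sublocale L: bounded_bilinear lact by (rule bounded_bilinear_lact)
sublocale R: bounded_bilinear ract by (rule bounded_bilinear_ract)

lemma act_scaleC:
  "(c *\<^sub>C a) \<rhd> x = c *\<^sub>C (a \<rhd> x)" "a \<rhd> (c *\<^sub>C x) = c *\<^sub>C (a \<rhd> x)"
  "(c *\<^sub>C x) \<lhd> a = c *\<^sub>C (x \<lhd> a)" "x \<lhd> (c *\<^sub>C a) = c *\<^sub>C (x \<lhd> a)"
  using clinear_lact_left clinear_lact_right clinear_ract_left clinear_ract_right
  by (auto simp: clinear_iff)

lemmas act_simps = L.add_left L.add_right L.diff_left L.diff_right L.minus_left L.minus_right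
  L.scaleR_left L.scaleR_right L.zero_left L.zero_right
  R.add_left R.add_right R.diff_left R.diff_right R.minus_left R.minus_right
  R.scaleR_left R.scaleR_right R.zero_left R.zero_right

lemma zero_product_form_anti_derivable:
  assumes T: "bounded_clinear T" and "anti_derivable_at_zero lact ract T"
  shows "zero_product_form (\<lambda>a b. T b \<lhd> a + b \<rhd> T a)"
proof (rule zero_product_form.intro)
  have bl: "bounded_linear T" using T by (simp add: bounded_clinear_def)
  have 1: "bounded_bilinear (\<lambda>a b. T b \<lhd> a)"
    using bounded_bilinear.flip[OF R.comp[OF bl bounded_linear_ident]] .
  have 2: "bounded_bilinear (\<lambda>a b. b \<rhd> T a)"
    using bounded_bilinear.flip[OF L.comp[OF bounded_linear_ident bl]] .
  show "bounded_bilinear (\<lambda>a b. T b \<lhd> a + b \<rhd> T a)"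
  proof
    obtain K K' where K: "\<And>a b. norm (T b \<lhd> a) \<le> norm a * norm b * K"
      "\<And>a b. norm (b \<rhd> T a) \<le> norm a * norm b * K'"
      using bounded_bilinear.bounded[OF 1] bounded_bilinear.bounded[OF 2] by blast
    have "norm (T b \<lhd> a + b \<rhd> T a) \<le> norm a * norm b * (K + K')" for a b
      unfolding distrib_left by (rule norm_triangle_mono[OF K])
    then show "\<exists>K. \<forall>a b. norm (T b \<lhd> a + b \<rhd> T a) \<le> norm a * norm b * K"
      by blast
  qed (simp_all add: linear_simps[OF bl] L.add_left L.add_right R.add_left R.add_right
      L.scaleR_left L.scaleR_right R.scaleR_left R.scaleR_right scaleR_add_right)
  show "a * b = 0 \<Longrightarrow> T b \<lhd> a + b \<rhd> T a = 0" for a b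
    using assms(2) by (simp add: anti_derivable_at_zero_def)
qed (use T in \<open>auto simp: bounded_clinear_def clinear_iff act_scaleC scaleC_add_right\<close>)

text \<open>
  The map \<open>d = T - \<xi>\<close> satisfies \<open>d (a b) = b d(a) + d(b) a - 2 \<xi> [a, b]\<close>. Expanding \<open>d (a b c)\<close>
  in both ways gives \<open>[c, b] d(a) + d(c) [a, b] = 0\<close>, in particular \<open>d(c) [a, c] = 0\<close>. Polarizing this,
  \<open>d (a b) [a, b] = - d(b) a [a, b]\<close>, and \<open>a [a, b] = [a a, b] - [a, b] a\<close> makes that zero; expanding
  \<open>d (a b)\<close> instead, the only term that survives is \<open>- 2 \<xi> [a, b]\<^sup>2\<close>.
\<close>

lemma annihilates_commutator_square:
  assumes T: "clinear T" and central: "\<And>a. \<xi> \<lhd> a = a \<rhd> \<xi>"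
    and eq: "\<And>a b. T (a * b) = b \<rhd> T a + T b \<lhd> a - \<xi> \<lhd> (a * b)"
  shows "\<xi> \<lhd> (commutator a b * commutator a b) = 0"
proof -
  define d where "d a = T a - \<xi> \<lhd> a" for a
  have d_add: "d (a + b) = d a + d b" for a b
    using T by (simp add: d_def clinear_iff act_simps)
  have cc: "a \<rhd> (\<xi> \<lhd> b) = \<xi> \<lhd> a \<lhd> b" for a b
    by (simp add: central lact_ract)
  have cc2: "a \<rhd> (\<xi> \<lhd> b \<lhd> c) = \<xi> \<lhd> a \<lhd> b \<lhd> c" for a b c
    by (metis cc lact_ract)
  have d: "d (a * b) = b \<rhd> d a + d b \<lhd> a + 2 *\<^sub>R (\<xi> \<lhd> b \<lhd> a) - 2 *\<^sub>R (\<xi> \<lhd> a \<lhd> b)" for a b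
    by (simp add: d_def eq act_simps cc ract_mult scaleR_2)
  have assoc: "c \<rhd> b \<rhd> d a - b \<rhd> c \<rhd> d a + d c \<lhd> a \<lhd> b - d c \<lhd> b \<lhd> a = 0" for a b c
  proof -
    have "d (a * b * c) = d (a * (b * c))" by (simp add: mult.assoc)
    then show ?thesis
      unfolding d[of "a * b" c] d[of a "b * c"] d[of a b] d[of b c]
      by (simp add: lact_mult ract_mult act_simps cc cc2 lact_ract algebra_simps)
  qed
  have self: "d c \<lhd> (a * c - c * a) = 0" for a c
    using assoc[of c c a] by (simp add: act_simps ract_mult)
  have polar: "d c \<lhd> (a * c' - c' * a) = - (d c' \<lhd> (a * c - c * a))" for a c c'
    using self[of "c + c'" a] self[of c a] self[of c' a]
    by (simp add: d_add act_simps distrib_left distrib_right add_eq_0_iff algebra_simps)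
  define k where "k = a * b - b * a"
  have "d b \<lhd> (a * k) = d b \<lhd> (a * a * b - b * (a * a)) - d b \<lhd> (a * b - b * a) \<lhd> a"
    by (simp add: k_def act_simps ract_mult algebra_simps)
  then have bk: "d b \<lhd> (a * k) = 0"
    using self[of b "a * a"] self[of b a] by (simp add: act_simps)
  have "d (a * b) \<lhd> k = - (d b \<lhd> (a * (a * b) - a * b * a))"
    unfolding k_def by (rule polar)
  also have "a * (a * b) - a * b * a = a * k"
    by (simp add: k_def algebra_simps)
  finally have 1: "d (a * b) \<lhd> k = 0" using bk by (simp add: act_simps)
  have ak: "d a \<lhd> k = 0"
    using self[of a b] by (simp add: k_def act_simps)
  have "d (a * b) \<lhd> k = b \<rhd> (d a \<lhd> k) + d b \<lhd> (a * k) - 2 *\<^sub>R (\<xi> \<lhd> (k * k))"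
    by (simp add: d k_def act_simps ract_mult lact_ract left_diff_distrib algebra_simps)
  with 1 ak bk have "\<xi> \<lhd> (k * k) = 0" by (simp add: act_simps)
  then show ?thesis by (simp add: commutator_def k_def)
qed

end

locale cstar_bimodule = banach_bimodule lact ract
  for lact :: "'a::cstar_algebra \<Rightarrow> 'x::complex_banach \<Rightarrow> 'x"  (infixr "\<rhd>" 75)
    and ract :: "'x \<Rightarrow> 'a \<Rightarrow> 'x"  (infixl "\<lhd>" 75)
begin

text \<open>
  Approximate \<open>h\<close> by \<open>h * e\<close> with \<open>e\<close> in the right ideal generated by \<open>h\<^sup>2\<close>: then \<open>\<xi> e = 0\<close>, and
  centrality moves \<open>h\<close> out of the way, \<open>\<xi> h e = h \<xi> e = 0\<close>.
\<close>

lemma annihilates_selfadjoint_of_square: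
  assumes central: "\<And>a. \<xi> \<lhd> a = a \<rhd> \<xi>" and h: "star h = h" "\<xi> \<lhd> (h * h) = 0"
  shows "\<xi> \<lhd> h = 0"
proof -
  obtain K where K: "K > 0" "\<And>x a. norm (x \<lhd> a) \<le> norm x * norm a * K"
    using R.pos_bounded by blast
  have "norm (\<xi> \<lhd> h) \<le> 0 + \<epsilon>" if "\<epsilon> > 0" for \<epsilon>
  proof -
    define \<delta> where "\<delta> = \<epsilon> / (norm \<xi> * K + 1)"
    have pos: "norm \<xi> * K + 1 > 0" using K(1) by (simp add: add_nonneg_pos)
    then have "\<delta> > 0" using that by (simp add: \<delta>_def)
    then obtain e r y where e: "norm (h - h * e) < \<delta>" "e = r *\<^sub>R (h * h) + h * h * y"
      using approximate_unit_selfadjoint[OF h(1)] by metis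
    have "\<xi> \<lhd> e = 0"
      unfolding e(2) using h(2) by (simp add: act_simps ract_mult)
    then have "\<xi> \<lhd> (h * e) = 0"
      unfolding ract_mult central[of h] lact_ract by (simp add: act_simps)
    then have "norm (\<xi> \<lhd> h) = norm (\<xi> \<lhd> (h - h * e))"
      by (simp add: act_simps)
    also have "\<dots> \<le> norm \<xi> * norm (h - h * e) * K" by (rule K(2))
    also have "\<dots> \<le> norm \<xi> * \<delta> * K"
      using e(1) K(1) by (intro mult_right_mono mult_left_mono) auto
    also have "\<dots> \<le> (norm \<xi> * K + 1) * \<delta>"
      using \<open>\<delta> > 0\<close> by (simp add: algebra_simps)
    also have "\<dots> = \<epsilon>" using pos by (simp add: \<delta>_def)
    finally show ?thesis by simp
  qed
  then have "norm (\<xi> \<lhd> h) \<le> 0" by (rule field_le_epsilon)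
  then show ?thesis by simp
qed

text \<open>
  The commutator of selfadjoint elements becomes selfadjoint after multiplication by \<open>\<i>\<close>; the general case
  follows by bilinearity.
\<close>

lemma annihilates_commutator:
  assumes T: "clinear T" and central: "\<And>a. \<xi> \<lhd> a = a \<rhd> \<xi>"
    and eq: "\<And>a b. T (a * b) = b \<rhd> T a + T b \<lhd> a - \<xi> \<lhd> (a * b)"
  shows "\<xi> \<lhd> commutator a b = 0"
proof -
  have sa: "\<xi> \<lhd> (a * b - b * a) = 0" if "star a = a" "star b = b" for a b
  proof -
    define h where "h = \<i> *\<^sub>C (a * b - b * a)"
    have "star h = h"
      by (simp add: h_def star_scaleC star_linear_simps star_mult that complex_vector.scale_right_diff_distrib)
    moreover have "h * h = - ((a * b - b * a) * (a * b - b * a))"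
      by (simp add: h_def scaleC_mult_left scaleC_mult_right scaleC_scaleC complex_vector.scale_minus_left scaleC_one)
    then have "\<xi> \<lhd> (h * h) = 0"
      using annihilates_commutator_square[OF assms, of a b] by (simp add: act_simps commutator_def)
    ultimately have "\<xi> \<lhd> h = 0"
      using annihilates_selfadjoint_of_square[OF central] by blast
    then have "(- \<i>) *\<^sub>C (\<xi> \<lhd> h) = 0" by simp
    then show ?thesis
      by (simp add: h_def act_scaleC scaleC_scaleC scaleC_one)
  qed
  obtain h k where hk: "star h = h" "star k = k" "a = h + \<i> *\<^sub>C k"
    by (rule selfadjoint_decomposition)
  obtain h' k' where hk': "star h' = h'" "star k' = k'" "b = h' + \<i> *\<^sub>C k'"
    by (rule selfadjoint_decomposition)
  define p q r t where "p = h * h' - h' * h" and "q = h * k' - k' * h"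
    and "r = k * h' - h' * k" and "t = k * k' - k' * k"
  have "a * b - b * a = p + \<i> *\<^sub>C q + \<i> *\<^sub>C r - t"
    unfolding hk hk' p_def q_def r_def t_def
    by (simp add: distrib_left distrib_right scaleC_mult_left scaleC_mult_right scaleC_scaleC
        complex_vector.scale_minus_left scaleC_one complex_vector.scale_right_diff_distrib scaleC_add_right)
  moreover have "\<xi> \<lhd> p = 0" "\<xi> \<lhd> q = 0" "\<xi> \<lhd> r = 0" "\<xi> \<lhd> t = 0"
    unfolding p_def q_def r_def t_def by (intro sa hk hk')+
  ultimately show ?thesis
    by (simp add: commutator_def act_simps act_scaleC)
qed

text \<open>
  The vectors with this property form a subspace that contains every \<open>a x b\<close>; it is closed because the
  approximate identity is bounded.
\<close>

lemma essential_tendsto: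
  assumes ess: "essential_banach_bimodule lact ract"
    and bdd: "eventually (\<lambda>e. norm e \<le> 2) F"
    and ident: "\<And>a. ((\<lambda>e. e * a) \<longlongrightarrow> a) F" "\<And>a. ((\<lambda>e. a * e) \<longlongrightarrow> a) F"
  shows "((\<lambda>e. z \<lhd> e) \<longlongrightarrow> z) F" and "((\<lambda>e. e \<rhd> z) \<longlongrightarrow> z) F"
proof -
  define r where "r e z = z \<lhd> e" for e z
  define V where "V = {z. ((\<lambda>e. r e z) \<longlongrightarrow> z) F \<and> ((\<lambda>e. e \<rhd> z) \<longlongrightarrow> z) F}"
  obtain K where K: "K > 0" "\<And>x a. norm (x \<lhd> a) \<le> norm x * norm a * K"
    using R.pos_bounded by blast
  obtain K' where K': "K' > 0" "\<And>a x. norm (a \<rhd> x) \<le> norm a * norm x * K'"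
    using L.pos_bounded by blast
  have sub: "complex_vector.subspace V"
  proof (rule complex_vector.subspaceI)
    have "r e 0 = 0" for e
      by (simp add: r_def R.zero_left)
    then show "0 \<in> V" by (simp add: V_def L.zero_right)
    have "r e (x + y) = r e x + r e y" "r e (c *\<^sub>C x) = c *\<^sub>C r e x" for e x y c
      by (simp_all add: r_def act_simps act_scaleC)
    then show "x + y \<in> V" "c *\<^sub>C x \<in> V" if "x \<in> V" "y \<in> V" for x y c
      using that tendsto_add bounded_linear.tendsto[OF bounded_linear_scaleC]
      by (auto simp: V_def act_simps act_scaleC)
  qed
  have "{(a \<rhd> x) \<lhd> b |a x b. True} \<subseteq> V"
  proof clarify
    fix a x b
    have "r e ((a \<rhd> x) \<lhd> b) = (a \<rhd> x) \<lhd> (b * e)" "e \<rhd> ((a \<rhd> x) \<lhd> b) = (e * a) \<rhd> (x \<lhd> b)" for e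
      by (simp_all add: r_def ract_mult lact_mult lact_ract)
    moreover have "((\<lambda>e. (a \<rhd> x) \<lhd> (b * e)) \<longlongrightarrow> (a \<rhd> x) \<lhd> b) F"
      by (intro R.tendsto tendsto_const ident)
    moreover have "((\<lambda>e. (e * a) \<rhd> (x \<lhd> b)) \<longlongrightarrow> (a \<rhd> x) \<lhd> b) F"
      unfolding lact_ract by (intro L.tendsto tendsto_const ident)
    ultimately show "(a \<rhd> x) \<lhd> b \<in> V"
      by (simp only: V_def mem_Collect_eq simp_thms)
  qed
  then have span: "cspan {(a \<rhd> x) \<lhd> b |a x b. True} \<subseteq> V"
    by (rule complex_vector.span_minimal[OF _ sub])
  have "z \<in> V"
  proof -
    have appr: "\<exists>v\<in>V. norm (z - v) < \<delta>" if pos: "\<delta> > 0" for \<delta>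
    proof -
      have "z \<in> closure (cspan {(a \<rhd> x) \<lhd> b |a x b. True})"
        using ess by (simp add: essential_banach_bimodule_def)
      then obtain v where "v \<in> cspan {(a \<rhd> x) \<lhd> b |a x b. True}" "dist v z < \<delta>"
        using pos unfolding closure_approachable by blast
      then show ?thesis using span by (auto simp: dist_norm norm_minus_commute)
    qed
    have lim: "((\<lambda>e. f e z) \<longlongrightarrow> z) F"
      if diff: "\<And>e x y. f e (x - y) = f e x - f e y" and bound: "\<And>e x. norm (f e x) \<le> norm e * norm x * C"
        and V: "\<And>v. v \<in> V \<Longrightarrow> ((\<lambda>e. f e v) \<longlongrightarrow> v) F" and C: "C > 0" for f C
      unfolding tendsto_iff
    proof (intro allI impI)
      fix \<epsilon> :: real
      assume "\<epsilon> > 0"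
      define \<delta> where "\<delta> = \<epsilon> / (2 * C + 2)"
      have "\<delta> > 0" "(2 * C + 2) * \<delta> = \<epsilon>"
        using \<open>\<epsilon> > 0\<close> C by (simp_all add: \<delta>_def)
      then have \<delta>: "\<delta> > 0" "2 * C * \<delta> + 2 * \<delta> = \<epsilon>"
        by (simp_all add: distrib_right)
      obtain v where v: "v \<in> V" "norm (z - v) < \<delta>" using appr[OF \<delta>(1)] by blast
      have "\<forall>\<^sub>F e in F. dist (f e v) v < \<delta>"
        using V[OF v(1)] \<delta>(1) by (simp add: tendsto_iff)
      then show "\<forall>\<^sub>F e in F. dist (f e z) z < \<epsilon>"
        using bdd
      proof eventually_elim
        case (elim e)
        have "norm (f e (z - v)) \<le> norm e * norm (z - v) * C" by (rule bound)
        also have "\<dots> \<le> 2 * \<delta> * C"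
          using elim(2) v(2) C by (intro mult_right_mono mult_mono) auto
        finally have "norm (f e z - f e v) \<le> 2 * C * \<delta>" by (simp add: diff mult_ac)
        moreover have "f e z - z = (f e z - f e v) + (f e v - v) + (v - z)" by simp
        then have "norm (f e z - z) \<le> norm (f e z - f e v) + norm (f e v - v) + norm (v - z)"
          by (metis norm_triangle_ineq norm_triangle_mono order_refl)
        ultimately show ?case
          using elim(1) v(2) \<delta>(2) by (simp add: dist_norm norm_minus_commute)
      qed
    qed
    have "((\<lambda>e. r e z) \<longlongrightarrow> z) F"
      by (rule lim[where f = r and C = K])
        (use K in \<open>auto simp: r_def act_simps V_def mult.commute\<close>)
    moreover have "((\<lambda>e. e \<rhd> z) \<longlongrightarrow> z) F"
      by (rule lim[where f = "\<lambda>e x. e \<rhd> x" and C = K']) (use K' in \<open>auto simp: act_simps V_def\<close>)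
    ultimately show ?thesis by (simp add: V_def)
  qed
  then show "((\<lambda>e. z \<lhd> e) \<longlongrightarrow> z) F" "((\<lambda>e. e \<rhd> z) \<longlongrightarrow> z) F"
    by (simp_all add: V_def r_def)
qed

end

text \<open>
  Weak* compactness of balls in a dual space, in the form needed here: by Tychonoff the functionals
  \<open>\<Phi> (f e)\<close> have a pointwise cluster point in a product of discs, which remains linear and bounded,
  and \<open>F'\<close> is a refinement of \<open>F\<close> along which they converge to it.
\<close>

lemma bounded_clinear_weak_cluster_point:
  fixes \<Phi> :: "'x::complex_banach \<Rightarrow> 'y::complex_banach \<Rightarrow> complex" and f :: "'i \<Rightarrow> 'x"
  assumes bij: "bij_betw \<Phi> UNIV {f. bounded_clinear f}"
    and norm: "\<And>x. onorm (\<Phi> x) = norm x"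
    and F: "F \<noteq> bot" and bdd: "eventually (\<lambda>e. norm (f e) \<le> B) F"
  obtains \<xi> F' where "F' \<le> F" "F' \<noteq> bot" "\<And>y. ((\<lambda>e. \<Phi> (f e) y) \<longlongrightarrow> \<Phi> \<xi> y) F'"
proof -
  have bcl: "bounded_clinear (\<Phi> x)" for x
    using bij by (auto simp: bij_betw_def)
  have bound: "norm (\<Phi> x y) \<le> norm x * norm y" for x y
    using onorm[of "\<Phi> x" y] bcl[of x] by (simp add: norm bounded_clinear_def)
  define h where "h e = \<Phi> (f e)" for e
  define K where "K = (\<Pi>\<^sub>E y\<in>(UNIV :: 'y set). cball (0::complex) (B * norm y))" 
  have "compactin (product_topology (\<lambda>_. euclidean) UNIV) K"
    unfolding K_def compactin_PiE by simp
  then have "compact K"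
    by (simp add: euclidean_product_topology)
  moreover have "filtermap h F \<noteq> bot" using F by (simp add: filtermap_bot_iff)
  moreover have "eventually (\<lambda>z. z \<in> K) (filtermap h F)"
    unfolding eventually_filtermap using bdd
  proof eventually_elim
    case (elim e)
    have "norm (h e y) \<le> B * norm y" for y
      using bound[of "f e" y] mult_right_mono[OF elim, of "norm y"] by (simp add: h_def)
    then show ?case by (auto simp: K_def)
  qed
  ultimately have "\<exists>\<psi>\<in>K. inf (nhds \<psi>) (filtermap h F) \<noteq> bot"
    unfolding compact_filter by (elim allE[of _ "filtermap h F"] impE)
  then obtain \<psi> where \<psi>: "\<psi> \<in> K" "inf (nhds \<psi>) (filtermap h F) \<noteq> bot"
    by (rule bexE)
  define F' where "F' = inf F (filtercomap h (nhds \<psi>))"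
  have F': "F' \<noteq> bot"
  proof
    assume "F' = bot"
    then have "eventually (\<lambda>_. False) F'" by simp
    then obtain P Q where PQ: "eventually P F" "eventually Q (filtercomap h (nhds \<psi>))" "\<And>x. P x \<Longrightarrow> \<not> Q x"
      unfolding F'_def eventually_inf by blast
    then obtain N where N: "eventually N (nhds \<psi>)" "\<And>x. N (h x) \<Longrightarrow> Q x"
      unfolding eventually_filtercomap by blast
    have "eventually (\<lambda>z. \<not> N z) (filtermap h F)"
      unfolding eventually_filtermap using PQ(1) by (rule eventually_mono) (use PQ(3) N(2) in blast)
    with N(1) have "eventually (\<lambda>_. False) (inf (nhds \<psi>) (filtermap h F))"
      unfolding eventually_inf by blast
    with \<psi>(2) show False by (simp add: trivial_limit_def)
  qed
  have "filtermap h F' \<le> filtermap h (filtercomap h (nhds \<psi>))"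
    by (rule filtermap_mono) (simp add: F'_def)
  also have "\<dots> \<le> nhds \<psi>" by (rule filtermap_filtercomap)
  finally have "(h \<longlongrightarrow> \<psi>) F'" by (simp add: filterlim_def)
  then have lim: "((\<lambda>e. h e y) \<longlongrightarrow> \<psi> y) F'" for y
    using continuous_on_tendsto_compose[OF continuous_on_product_coordinates[of y], of h \<psi> F'] by simp
  have add: "\<psi> (x + y) = \<psi> x + \<psi> y" for x y
  proof (rule tendsto_unique[OF F' lim])
    show "((\<lambda>e. h e (x + y)) \<longlongrightarrow> \<psi> x + \<psi> y) F'"
      using tendsto_add[OF lim[of x] lim[of y]] bcl by (simp add: h_def bounded_clinear_def clinear_iff)
  qed
  have scale: "\<psi> (c *\<^sub>C x) = c *\<^sub>C \<psi> x" for c x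
  proof (rule tendsto_unique[OF F' lim])
    show "((\<lambda>e. h e (c *\<^sub>C x)) \<longlongrightarrow> c *\<^sub>C \<psi> x) F'"
      using bounded_linear.tendsto[OF bounded_linear_scaleC lim[of x], of c] bcl
      by (simp add: h_def bounded_clinear_def clinear_iff)
  qed
  have "bounded_linear \<psi>"
    by (rule bounded_linear_intro[where K = B])
      (use add scale \<psi>(1) in \<open>auto simp: scaleR_scaleC K_def PiE_iff mult.commute\<close>)
  then have "bounded_clinear \<psi>"
    using add scale by (simp add: bounded_clinear_def clinear_iff)
  then obtain \<xi> where "\<Phi> \<xi> = \<psi>"
    using bij unfolding bij_betw_def by (metis (mono_tags) imageE mem_Collect_eq)
  then show thesis
    using that[of F' \<xi>] F' lim by (simp add: F'_def h_def)
qed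

context cstar_bimodule
begin

text \<open>
  Essentiality makes the unit act as the identity on the module, so \<open>\<xi> = T u\<close> results from setting
  one of the variables of the balance identity to the unit \<open>u\<close>.
\<close>

lemma implementing_element_unital:
  assumes ess: "essential_banach_bimodule lact ract" and "unital_algebra TYPE('a)"
    and balanced: "\<And>a x b. T b \<lhd> (a * x) + b \<rhd> T (a * x) = T (x * b) \<lhd> a + (x * b) \<rhd> T a"
  shows "\<exists>\<xi>. (\<forall>x b. T b \<lhd> x + b \<rhd> T x = T (x * b) + (x * b) \<rhd> \<xi>) \<and>
    (\<forall>a x. \<xi> \<lhd> (a * x) + T (a * x) = T x \<lhd> a + x \<rhd> T a)"
proof -
  obtain u :: 'a where u: "\<And>a. u * a = a" "\<And>a. a * u = a"
    using assms(2) by (auto simp: unital_algebra_def)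
  obtain F :: "'a filter" where F: "F \<noteq> bot" "eventually (\<lambda>e. norm e \<le> 2) F"
    "\<And>a. ((\<lambda>e. e * a) \<longlongrightarrow> a) F" "\<And>a. ((\<lambda>e. a * e) \<longlongrightarrow> a) F"
    using cstar_approximate_identity by metis
  note lim = essential_tendsto[OF ess F(2-4)]
  have ru: "z \<lhd> u = z" for z
  proof (rule tendsto_unique[OF F(1) _ lim(1)])
    show "((\<lambda>e. z \<lhd> e) \<longlongrightarrow> z \<lhd> u) F"
      using R.tendsto[OF lim(1) tendsto_const, of z u] by (simp add: ract_mult[symmetric] u)
  qed
  have lu: "u \<rhd> z = z" for z
  proof (rule tendsto_unique[OF F(1) _ lim(2)])
    show "((\<lambda>e. e \<rhd> z) \<longlongrightarrow> u \<rhd> z) F"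
      using L.tendsto[OF tendsto_const lim(2), of u z] by (simp add: lact_mult[symmetric] u)
  qed
  show ?thesis
    using balanced[of _ u] balanced[of u] by (intro exI[of _ "T u"]) (simp add: u ru lu)
qed

text \<open>
  The balance identity is taken to the limit along an approximate identity. The terms in which \<open>T\<close> is not
  applied to the approximate identity alone converge in norm; the module operations on a dual module are weak*
  continuous, which covers the remaining one.
\<close>

lemma implementing_element_dual:
  assumes ess: "essential_banach_bimodule lact ract"
    and dual: "dual_banach_bimodule TYPE('y::complex_banach) lact ract"
    and T: "bounded_linear T"
    and balanced: "\<And>a x b. T b \<lhd> (a * x) + b \<rhd> T (a * x) = T (x * b) \<lhd> a + (x * b) \<rhd> T a"
  shows "\<exists>\<xi>. (\<forall>x b. T b \<lhd> x + b \<rhd> T x = T (x * b) + (x * b) \<rhd> \<xi>) \<and>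
    (\<forall>a x. \<xi> \<lhd> (a * x) + T (a * x) = T x \<lhd> a + x \<rhd> T a)"
proof -
  obtain lactY :: "'a \<Rightarrow> 'y \<Rightarrow> 'y" and ractY :: "'y \<Rightarrow> 'a \<Rightarrow> 'y" and \<Phi> :: "'x \<Rightarrow> 'y \<Rightarrow> complex"
    where bij: "bij_betw \<Phi> UNIV {f. bounded_clinear f}"
      and add: "\<And>x x' y. \<Phi> (x + x') y = \<Phi> x y + \<Phi> x' y"
      and scale: "\<And>c x y. \<Phi> (c *\<^sub>C x) y = c * \<Phi> x y"
      and nrm: "\<And>x. onorm (\<Phi> x) = norm x"
      and lY: "\<And>a x y. \<Phi> (a \<rhd> x) y = \<Phi> x (ractY y a)"
      and rY: "\<And>a x y. \<Phi> (x \<lhd> a) y = \<Phi> x (lactY a y)"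
    using dual unfolding dual_banach_bimodule_def by blast
  have bl: "bounded_linear (\<lambda>x. \<Phi> x y)" for y
  proof (rule bounded_linear_intro[where K = "norm y"])
    show "norm (\<Phi> x y) \<le> norm x * norm y" for x
      using onorm[of "\<Phi> x" y] bij by (auto simp: nrm bounded_clinear_def bij_betw_def)
  qed (simp_all add: add scale scaleR_scaleC scaleC_complex_def)
  have inj: "x = x'" if "\<And>y. \<Phi> x y = \<Phi> x' y" for x x'
  proof -
    have "\<Phi> x = \<Phi> x'" using that by (rule ext)
    then show ?thesis using bij by (auto simp: bij_betw_def dest: injD)
  qed
  obtain F :: "'a filter" where F: "F \<noteq> bot" "eventually (\<lambda>e. norm e \<le> 2) F"
    "\<And>a. ((\<lambda>e. e * a) \<longlongrightarrow> a) F" "\<And>a. ((\<lambda>e. a * e) \<longlongrightarrow> a) F"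
    using cstar_approximate_identity by metis
  obtain C where C: "C > 0" "\<And>a. norm (T a) \<le> norm a * C"
    using bounded_linear.pos_bounded[OF T] by blast
  have "eventually (\<lambda>e. norm (T e) \<le> 2 * C) F"
    using F(2)
  proof eventually_elim
    case (elim e)
    show ?case using order_trans[OF C(2)[of e] mult_right_mono[OF elim, of C]] C(1) by simp
  qed
  from bounded_clinear_weak_cluster_point[OF bij nrm F(1) this]
  obtain \<xi> F' where F': "F' \<le> F" "F' \<noteq> bot" and w: "\<And>y. ((\<lambda>e. \<Phi> (T e) y) \<longlongrightarrow> \<Phi> \<xi> y) F'"
    by metis
  note mono = tendsto_mono[OF F'(1)]
  note lim = essential_tendsto[OF ess F(2-4), THEN mono] and unit = F(3,4)[THEN mono]
  have "T b \<lhd> x + b \<rhd> T x = T (x * b) + (x * b) \<rhd> \<xi>" for x b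
  proof (rule inj, rule tendsto_unique[OF F'(2)])
    fix y
    show "((\<lambda>e. \<Phi> (T b \<lhd> (e * x) + b \<rhd> T (e * x)) y) \<longlongrightarrow> \<Phi> (T b \<lhd> x + b \<rhd> T x) y) F'"
      by (intro bounded_linear.tendsto[OF bl] tendsto_add R.tendsto L.tendsto tendsto_const
          bounded_linear.tendsto[OF T] unit)
    have "((\<lambda>e. \<Phi> (T (x * b) \<lhd> e) y + \<Phi> (T e) (ractY y (x * b))) \<longlongrightarrow>
        \<Phi> (T (x * b)) y + \<Phi> \<xi> (ractY y (x * b))) F'"
      by (intro tendsto_add bounded_linear.tendsto[OF bl] lim w)
    then show "((\<lambda>e. \<Phi> (T b \<lhd> (e * x) + b \<rhd> T (e * x)) y) \<longlongrightarrow> \<Phi> (T (x * b) + (x * b) \<rhd> \<xi>) y) F'"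
      by (simp add: balanced add lY)
  qed
  moreover have "\<xi> \<lhd> (a * x) + T (a * x) = T x \<lhd> a + x \<rhd> T a" for a x
  proof (rule inj, rule tendsto_unique[OF F'(2)])
    fix y
    have "((\<lambda>e. \<Phi> (T e) (lactY (a * x) y) + \<Phi> (e \<rhd> T (a * x)) y) \<longlongrightarrow>
        \<Phi> \<xi> (lactY (a * x) y) + \<Phi> (T (a * x)) y) F'"
      by (intro tendsto_add bounded_linear.tendsto[OF bl] lim w)
    then show "((\<lambda>e. \<Phi> (T e \<lhd> (a * x) + e \<rhd> T (a * x)) y) \<longlongrightarrow> \<Phi> (\<xi> \<lhd> (a * x) + T (a * x)) y) F'"
      by (simp add: add rY)
    show "((\<lambda>e. \<Phi> (T e \<lhd> (a * x) + e \<rhd> T (a * x)) y) \<longlongrightarrow> \<Phi> (T x \<lhd> a + x \<rhd> T a) y) F'"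
      unfolding balanced
      by (intro bounded_linear.tendsto[OF bl] tendsto_add R.tendsto L.tendsto tendsto_const
          bounded_linear.tendsto[OF T] unit)
  qed
  ultimately show ?thesis by blast
qed

text \<open>
  Comparing the two expressions for \<open>T (x * b)\<close> shows that \<open>\<xi>\<close> commutes with products, and every
  element is a limit of products.
\<close>

lemma implementing_element_central:
  assumes U: "\<And>x b. T b \<lhd> x + b \<rhd> T x = T (x * b) + (x * b) \<rhd> \<xi>"
    "\<And>a x. \<xi> \<lhd> (a * x) + T (a * x) = T x \<lhd> a + x \<rhd> T a"
  shows "\<xi> \<lhd> a = a \<rhd> \<xi>"
proof -
  have mul: "(x * b) \<rhd> \<xi> = \<xi> \<lhd> (x * b)" for x b
  proof -
    have "T (x * b) + (x * b) \<rhd> \<xi> = T (x * b) + \<xi> \<lhd> (x * b)"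
      using U(1)[of b x] U(2)[of x b] by (simp add: add.commute)
    then show ?thesis by simp
  qed
  obtain F :: "'a filter" where F: "F \<noteq> bot" "\<And>a. ((\<lambda>e. e * a) \<longlongrightarrow> a) F"
    using cstar_approximate_identity by metis
  show ?thesis
  proof (rule tendsto_unique[OF F(1)])
    show "((\<lambda>e. \<xi> \<lhd> (e * a)) \<longlongrightarrow> \<xi> \<lhd> a) F"
      by (intro R.tendsto tendsto_const F)
    show "((\<lambda>e. \<xi> \<lhd> (e * a)) \<longlongrightarrow> a \<rhd> \<xi>) F"
      unfolding mul[symmetric] by (intro L.tendsto tendsto_const F)
  qed
qed

end

theorem mainTheorem2:
  fixes lact :: "'a::cstar_algebra \<Rightarrow> 'x::complex_banach \<Rightarrow> 'x"  (infixr "\<rhd>" 75)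
    and ract :: "'x \<Rightarrow> 'a \<Rightarrow> 'x"  (infixl "\<lhd>" 75)
    and T :: "'a \<Rightarrow> 'x"
  assumes "essential_banach_bimodule lact ract"
    and "bounded_clinear T"
    and "unital_algebra TYPE('a) \<or> dual_banach_bimodule TYPE('y::complex_banach) lact ract"
  shows "anti_derivable_at_zero lact ract T \<longleftrightarrow>
    (\<exists>d \<xi>. anti_derivation lact ract d \<and>
      (\<forall>a. \<xi> \<lhd> a = a \<rhd> \<xi>) \<and>
      (\<forall>a b. \<xi> \<lhd> commutator a b = 0) \<and>
      (\<forall>a b. T (a * b) = b \<rhd> T a + T b \<lhd> a - (b \<rhd> \<xi>) \<lhd> a) \<and>
      (\<forall>a. T a = d a + \<xi> \<lhd> a))"
proof
  have "banach_bimodule lact ract"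
    using assms(1) by (simp add: essential_banach_bimodule_def)
  then interpret cstar_bimodule lact ract
    by (simp add: cstar_bimodule_def)
  have lin: "clinear T" and bl: "bounded_linear T"
    using assms(2) by (simp_all add: bounded_clinear_def)
  {
    assume "anti_derivable_at_zero lact ract T"
    then have "zero_product_form (\<lambda>a b. T b \<lhd> a + b \<rhd> T a)"
      by (rule zero_product_form_anti_derivable[OF assms(2)])
    then have balanced: "T b \<lhd> (a * x) + b \<rhd> T (a * x) = T (x * b) \<lhd> a + (x * b) \<rhd> T a" for a x b
      by (rule cstar_zero_product_determined)
    have "\<exists>\<xi>. (\<forall>x b. T b \<lhd> x + b \<rhd> T x = T (x * b) + (x * b) \<rhd> \<xi>) \<and>
        (\<forall>a x. \<xi> \<lhd> (a * x) + T (a * x) = T x \<lhd> a + x \<rhd> T a)"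
      using assms(3) implementing_element_unital[OF assms(1) _ balanced]
        implementing_element_dual[OF assms(1) _ bl balanced] by blast
    then obtain \<xi> where U: "\<And>x b. T b \<lhd> x + b \<rhd> T x = T (x * b) + (x * b) \<rhd> \<xi>"
      "\<And>a x. \<xi> \<lhd> (a * x) + T (a * x) = T x \<lhd> a + x \<rhd> T a"
      by blast
    note central = implementing_element_central[OF U]
    have eq: "T (a * b) = b \<rhd> T a + T b \<lhd> a - \<xi> \<lhd> (a * b)" for a b
      using U(2)[of a b] by (simp add: algebra_simps)
    note comm = annihilates_commutator[OF lin central eq]
    have swap: "\<xi> \<lhd> (a * b) = \<xi> \<lhd> (b * a)" for a b
      using comm[of a b] by (simp add: commutator_def act_simps)
    have bxa: "(b \<rhd> \<xi>) \<lhd> a = \<xi> \<lhd> (b * a)" for a b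
      by (simp add: central[symmetric] ract_mult)
    define d where "d a = T a - \<xi> \<lhd> a" for a
    have "d (a * b) = d b \<lhd> a + b \<rhd> d a" for a b
      using bxa[of b a] swap[of a b] by (simp add: d_def eq act_simps lact_ract ract_mult)
    moreover have "clinear d"
      using lin by (simp add: d_def clinear_iff act_simps act_scaleC complex_vector.scale_right_diff_distrib)
    ultimately have "anti_derivation lact ract d"
      by (simp add: anti_derivation_def)
    moreover have "T (a * b) = b \<rhd> T a + T b \<lhd> a - (b \<rhd> \<xi>) \<lhd> a" for a b
      by (simp only: eq bxa swap[of a b])
    moreover have "T a = d a + \<xi> \<lhd> a" for a
      by (simp add: d_def)
    ultimately show "\<exists>d \<xi>. anti_derivation lact ract d \<and> (\<forall>a. \<xi> \<lhd> a = a \<rhd> \<xi>) \<and>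
      (\<forall>a b. \<xi> \<lhd> commutator a b = 0) \<and>
      (\<forall>a b. T (a * b) = b \<rhd> T a + T b \<lhd> a - (b \<rhd> \<xi>) \<lhd> a) \<and> (\<forall>a. T a = d a + \<xi> \<lhd> a)"
      using central comm by blast
  }
  {
    assume "\<exists>d \<xi>. anti_derivation lact ract d \<and> (\<forall>a. \<xi> \<lhd> a = a \<rhd> \<xi>) \<and>
      (\<forall>a b. \<xi> \<lhd> commutator a b = 0) \<and>
      (\<forall>a b. T (a * b) = b \<rhd> T a + T b \<lhd> a - (b \<rhd> \<xi>) \<lhd> a) \<and> (\<forall>a. T a = d a + \<xi> \<lhd> a)"
    then obtain \<xi> where central: "\<And>a. \<xi> \<lhd> a = a \<rhd> \<xi>" and comm: "\<And>a b. \<xi> \<lhd> commutator a b = 0"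
      and eq: "\<And>a b. T (a * b) = b \<rhd> T a + T b \<lhd> a - (b \<rhd> \<xi>) \<lhd> a"
      by blast
    have "T b \<lhd> a + b \<rhd> T a = 0" if "a * b = 0" for a b
    proof -
      have "(b \<rhd> \<xi>) \<lhd> a = \<xi> \<lhd> (b * a)"
        by (simp add: central[symmetric] ract_mult)
      also have "\<dots> = \<xi> \<lhd> (a * b)"
        using comm[of a b] by (simp add: commutator_def act_simps)
      also have "\<dots> = 0" by (simp add: that act_simps)
      finally have "T (a * b) = b \<rhd> T a + T b \<lhd> a" by (simp add: eq)
      moreover have "T (a * b) = 0"
        using that linear_simps(3)[OF bl] by simp
      ultimately show ?thesis by (simp add: add.commute)
    qed
    then show "anti_derivable_at_zero lact ract T"
      by (simp add: anti_derivable_at_zero_def)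
  }
qed

end
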